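(* Let $c>0$ be a real number, let $u_0\in H^3(\mathbb{S})$, and let $u\in C^0([0,T),H^3(\mathbb{S}))\cap C^1([0,T),H^2(\mathbb{S}))$, $0<T\le\infty$, be the corresponding solution of the periodic Cauchy problem $$ \begin{cases} u_t-u_{txx}+c\,u u_x=c\,u u_{xxx}, & x\in\mathbb{R},\ t>0,\\ u(0,x)=u_0(x), & x\in\mathbb{R},\\ u(t,x)=u(t,x+1), & x\in\mathbb{R},\ t>0. \end{cases} $$ If there exists a constant $M>0$ such that $$\|u(t,\cdot)\|_{L^\infty(\mathbb{S})}+\|u_x(t,\cdot)\|_{L^\infty(\mathbb{S})}<M\quad\text{for all } t\in[0,T),$$ then $\|u(t,\cdot)\|_{H^3(\mathbb{S})}$ does not blow up in finite time, i.e. if $T<\infty$ then $\sup_{t\in[0,T)}\|u(t,\cdot)\|_{H^3(\mathbb{S})}<\infty$.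
   Context: $\mathbb{S}$ denotes the circle, identified with $[0,1)$ (functions on $\mathbb{S}$ are $1$-periodic functions on $\mathbb{R}$), and $H^s(\mathbb{S})$ is the Sobolev space of order $s$ on the circle. Local well-posedness (known): for $u_0\in H^s(\mathbb{S})$, $s>3/2$, there is a unique solution $u\in C^0([0,T),H^s(\mathbb{S}))\cap C^1([0,T),H^{s-1}(\mathbb{S}))$ for some $T>0$, depending continuously on the initial data. *)

theory Defs
  imports "HOL-Probability.Probability"
begin

text \<open>
  Functions on the circle are 1-periodic functions on the real line, and the circle itself is
  represented by the fundamental domain \<open>{0..<1}\<close> with Lebesgue measure. Elements of Lebesgue and
  Sobolev spaces are represented by functions; everything below depends on such a function
  only up to null sets (apart from the periodicity requirement, which is pointwise).
\<close>

abbreviation circle :: "real measure" where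
  "circle \<equiv> lebesgue_on {0..<1}"

definition periodic1 :: "(real \<Rightarrow> real) \<Rightarrow> bool" where
  "periodic1 f \<longleftrightarrow> (\<forall>x. f (x + 1) = f x)"

definition fourier_coeff :: "(real \<Rightarrow> real) \<Rightarrow> int \<Rightarrow> complex" where
  "fourier_coeff f k = (LINT x|circle. complex_of_real (f x) * cis (- 2 * pi * of_int k * x))"

text \<open>
  For \<open>s \<ge> 0\<close> (the only case in which \<open>H\<^sup>s\<close> consists of functions and is used), \<open>H\<^sup>s\<close> is the space of
  square-integrable \<open>f\<close> for which the Fourier series of \<open>(1 - d\<^sup>2/dx\<^sup>2)\<^bsup>s/2\<^esup> f\<close> is square-summable.
\<close>

definition sobolev :: "real \<Rightarrow> (real \<Rightarrow> real) set" where
  "sobolev s = {f. periodic1 f \<and> f \<in> borel_measurable circle \<and> integrable circle (\<lambda>x. (f x)\<^sup>2) \<and>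
     (\<lambda>k::int. (1 + (2 * pi * of_int k)\<^sup>2) powr s * (cmod (fourier_coeff f k))\<^sup>2) summable_on UNIV}"

text \<open>Only meaningful on \<^term>\<open>sobolev s\<close>, since a divergent sum has value 0.\<close>

definition sobolev_norm :: "real \<Rightarrow> (real \<Rightarrow> real) \<Rightarrow> real" where
  "sobolev_norm s f =
     sqrt (\<Sum>\<^sub>\<infinity>k::int. (1 + (2 * pi * of_int k)\<^sup>2) powr s * (cmod (fourier_coeff f k))\<^sup>2)"

definition Linf_norm :: "(real \<Rightarrow> real) \<Rightarrow> ereal" where
  "Linf_norm f = esssup circle (\<lambda>x. ereal \<bar>f x\<bar>)"

definition smooth_periodic :: "(real \<Rightarrow> real) \<Rightarrow> bool" where
  "smooth_periodic \<phi> \<longleftrightarrow> periodic1 \<phi> \<and> (\<forall>n x. ((deriv ^^ n) \<phi>) differentiable (at x))"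

text \<open>\<open>g\<close> is an \<open>n\<close>-th weak derivative of \<open>f\<close> on the circle.\<close>

definition weak_deriv :: "nat \<Rightarrow> (real \<Rightarrow> real) \<Rightarrow> (real \<Rightarrow> real) \<Rightarrow> bool" where
  "weak_deriv n f g \<longleftrightarrow> periodic1 f \<and> periodic1 g \<and> integrable circle f \<and> integrable circle g \<and>
     (\<forall>\<phi>. smooth_periodic \<phi> \<longrightarrow>
        (LINT x|circle. f x * (deriv ^^ n) \<phi> x) = (-1) ^ n * (LINT x|circle. g x * \<phi> x))"

definition time_interval :: "ereal \<Rightarrow> real set" where
  "time_interval T = {t. 0 \<le> t \<and> ereal t < T}"

definition C0_sobolev :: "ereal \<Rightarrow> real \<Rightarrow> (real \<Rightarrow> real \<Rightarrow> real) \<Rightarrow> bool" where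
  "C0_sobolev T s u \<longleftrightarrow> (\<forall>t \<in> time_interval T. u t \<in> sobolev s \<and>
     ((\<lambda>r. sobolev_norm s (\<lambda>x. u r x - u t x)) \<longlongrightarrow> 0) (at t within time_interval T))"

text \<open>\<open>u\<close> is in \<open>C\<^sup>1([0,T), H\<^sup>s)\<close> with time derivative \<open>v\<close> (one-sided at time 0).\<close>

definition C1_sobolev ::
  "ereal \<Rightarrow> real \<Rightarrow> (real \<Rightarrow> real \<Rightarrow> real) \<Rightarrow> (real \<Rightarrow> real \<Rightarrow> real) \<Rightarrow> bool" where
  "C1_sobolev T s u v \<longleftrightarrow> C0_sobolev T s u \<and> C0_sobolev T s v \<and>
     (\<forall>t \<in> time_interval T.
        ((\<lambda>r. sobolev_norm s (\<lambda>x. (u r x - u t x) / (r - t) - v t x)) \<longlongrightarrow> 0)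
          (at t within time_interval T))"

text \<open>
  The solutions in \<open>C\<^sup>0([0,T), H\<^sup>3) \<inter> C\<^sup>1([0,T), H\<^sup>2)\<close> of the periodic Cauchy problem for
  \<open>u\<^sub>t - u\<^sub>t\<^sub>x\<^sub>x + c u u\<^sub>x = c u u\<^sub>x\<^sub>x\<^sub>x\<close>. In this class every term of the equation is in \<open>L\<^sup>2\<close> for fixed
  \<open>t\<close>, so that the equation is an identity for almost every \<open>x\<close>; space derivatives are weak ones.
\<close>

definition cauchy_solution ::
  "real \<Rightarrow> (real \<Rightarrow> real) \<Rightarrow> ereal \<Rightarrow> (real \<Rightarrow> real \<Rightarrow> real) \<Rightarrow> bool" where
  "cauchy_solution c u0 T u \<longleftrightarrow>
     C0_sobolev T 3 u \<and>
     (\<exists>ut. C1_sobolev T 2 u ut \<and>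
       (\<forall>t \<in> time_interval T. t > 0 \<longrightarrow>
         (\<exists>utxx ux uxxx.
            weak_deriv 2 (ut t) utxx \<and> weak_deriv 1 (u t) ux \<and> weak_deriv 3 (u t) uxxx \<and>
            (AE x in lebesgue. ut t x - utxx x + c * u t x * ux x = c * u t x * uxxx x)))) \<and>
     (AE x in lebesgue. u 0 x = u0 x) \<and>
     (\<forall>t \<in> time_interval T. t > 0 \<longrightarrow> (\<forall>x. u t x = u t (x + 1)))"

end

theory Submission
  imports Defs
begin

text \<open>
  With \<open>m = u - u\<^sub>x\<^sub>x\<close> the equation is the transport equation \<open>m\<^sub>t + c u m\<^sub>x = 0\<close>, and the \<open>H\<^sup>3\<close> norm of
  \<open>u\<close> is the \<open>H\<^sup>1\<close> norm of \<open>m\<close>. As \<open>m\<^sub>x\<close> is only in \<open>L\<^sup>2\<close>, the energy estimate is made for the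
  difference quotients \<open>(m(t, x + h) - m(t, x)) / h\<close>: the time derivative of their squared \<open>L\<^sup>2\<close> norm is at most
  \<open>3 c M\<close> times the squared \<open>H\<^sup>3\<close> norm of \<open>u\<close>, uniformly in \<open>h\<close>. One integrates in time, lets \<open>h\<close> tend to 0,
  bounds the mean of \<open>m\<close> by \<open>M\<close>, and concludes with Gronwall. All of this takes place on the Fourier coefficients
  \<open>a\<close> of \<open>u\<close>; the bound on \<open>u\<^sub>x\<close> enters through its Toeplitz form, and the nonlinear term becomes
  a convolution because \<open>u\<close> is almost everywhere the sum of its Fourier series.
\<close>

section \<open>Fourier series on the circle\<close>

text \<open>The time derivative of u exists only in H^2, so the H^3 norm itself cannot be
  differentiated in time; for fixed h the squared norm of the difference quotient of m is a bounded
  form on H^2 and can. With q = m(x + h) - m(x), the increment of u m_x splits as (u(x + h) - u(x))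
  m_x(x + h) + u q_x. The first factor is at most h M, and integrating by parts turns the pairing of
  u q_x with q into half of the integral of u_x q^2, up to sign. Since the L^2 norm of q is at most
  h times that of m_x, the two terms contribute M and M / 2 times h^2; differentiating a square
  doubles their sum, whence the 3 in 3 c M. Recovering the H^3 norm from the limit of the difference
  quotients costs another factor 2, so the final rate is 6 c M. The bound on u itself is spent on
  frequency zero, which difference quotients do not see.\<close>

definition fexp :: "int \<Rightarrow> real \<Rightarrow> complex" where
  "fexp k x = cis (2 * pi * of_int k * x)"

lemma norm_fexp [simp]: "norm (fexp k x) = 1"
  by (simp add: fexp_def)

lemma fexp_add: "fexp (j + k) x = fexp j x * fexp k x"
  by (simp add: fexp_def cis_mult algebra_simps)

lemma cnj_fexp: "cnj (fexp k x) = fexp (- k) x"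
  by (simp add: fexp_def cis_cnj)

lemma fexp_0 [simp]: "fexp 0 x = 1"
  by (simp add: fexp_def)

lemma fexp_diff: "fexp (j - k) x = fexp j x * cnj (fexp k x)"
  using fexp_add[of j "- k" x] by (simp add: cnj_fexp)

lemma continuous_fexp: "continuous_on S (fexp k)"
  unfolding fexp_def by (intro continuous_intros)

lemma circle_measurable_continuous:
  fixes g :: "real \<Rightarrow> 'b::euclidean_space"
  assumes "continuous_on UNIV g"
  shows "g \<in> borel_measurable circle"
  by (intro continuous_imp_measurable_on_sets_lebesgue continuous_on_subset[OF assms]) auto

lemma fexp_measurable [measurable]: "fexp k \<in> borel_measurable circle"
  by (rule circle_measurable_continuous[OF continuous_fexp])

lemma finite_measure_circle: "finite_measure circle"
  by (rule finite_measureI) (simp add: emeasure_restrict_space space_restrict_space)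

lemma fourier_coeff_fexp: "fourier_coeff f k = (LINT x|circle. complex_of_real (f x) * fexp (- k) x)"
  by (simp add: fourier_coeff_def fexp_def)

lemma integrable_circle_mult_bounded:
  fixes G h :: "real \<Rightarrow> complex"
  assumes "integrable circle G" "h \<in> borel_measurable circle" "\<And>x. norm (h x) \<le> B"
  shows "integrable circle (\<lambda>x. h x * G x)"
proof (rule Bochner_Integration.integrable_bound)
  show "integrable circle (\<lambda>x. B *\<^sub>R G x)" using assms(1) by simp
  show "(\<lambda>x. h x * G x) \<in> borel_measurable circle" using assms by measurable
  have "0 \<le> B" using assms(3)[of 0] norm_ge_zero order_trans by blast
  then show "AE x in circle. norm (h x * G x) \<le> norm (B *\<^sub>R G x)"
    using assms(3) by (auto simp: norm_mult intro!: mult_right_mono)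
qed

lemma integrable_circle_mult_fexp:
  assumes "integrable circle G"
  shows "integrable circle (\<lambda>x. G x * fexp k x)"
  using integrable_circle_mult_bounded[OF assms, of "fexp k" 1] by (simp add: mult.commute)

lemma integrable_circle_bounded:
  fixes h :: "real \<Rightarrow> complex"
  assumes "h \<in> borel_measurable circle" "\<And>x. norm (h x) \<le> B"
  shows "integrable circle h"
proof -
  interpret finite_measure circle by (rule finite_measure_circle)
  show ?thesis by (rule integrable_const_bound[OF _ assms(1)]) (use assms(2) in auto)
qed

lemma integrable_fexp: "integrable circle (fexp k)"
  by (rule integrable_circle_bounded[of _ 1]) auto

lemma integral_fexp: "(LINT x|circle. fexp k x) = (if k = 0 then 1 else 0)"
proof (cases "k = 0")
  case True
  then show ?thesis by (simp add: fexp_def measure_restrict_space space_restrict_space)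
next
  case False
  define w where "w = \<i> * complex_of_real (2 * pi * of_int k)"
  have w: "w \<noteq> 0" using False by (simp add: w_def)
  have fe: "fexp k x = exp (w * of_real x)" for x
    by (simp add: fexp_def cis_conv_exp w_def mult.assoc)
  have "((\<lambda>x. exp (w * complex_of_real x) / w) has_vector_derivative exp (w * of_real x)) (at x within {0..1})" for x
  proof -
    have "((\<lambda>z. exp (w * z) / w) has_field_derivative exp (w * of_real x)) (at (of_real x))"
      using w by (auto intro!: derivative_eq_intros)
    then show ?thesis
      by (rule has_vector_derivative_real_field)
  qed
  then have "((\<lambda>x. exp (w * complex_of_real x)) has_integral
      exp (w * of_real 1) / w - exp (w * of_real 0) / w) {0..1}"
    by (intro fundamental_theorem_of_calculus) auto
  moreover have "exp (w * of_real 1) = 1"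
    using fe[of 1] by (simp add: fexp_def complex_eq_iff)
  ultimately have "((\<lambda>x. exp (w * complex_of_real x)) has_integral 0) {0..1}" by simp
  then have "(fexp k has_integral 0) {0..1}"
    by (simp add: fe[abs_def])
  then have "(fexp k has_integral 0) {0..<1}"
    by (rule has_integral_spike_set_eq[THEN iffD1, rotated 2])
      (auto intro: negligible_subset[of "{1}"] negligible_subset[of "{}"])
  then have "integral {0..<1} (fexp k) = 0" by blast
  then show ?thesis using lebesgue_integral_eq_integral[OF integrable_fexp] False by simp
qed

section \<open>Absolutely convergent Fourier series\<close>

lemma uniform_limit_fourier_series:
  assumes "(\<lambda>k. norm (a k)) summable_on (UNIV :: int set)"
  shows "uniform_limit UNIV (\<lambda>F x. \<Sum>k\<in>F. a k * fexp k x) (\<lambda>x. \<Sum>\<^sub>\<infinity>k. a k * fexp k x)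
           (finite_subsets_at_top UNIV)"
  by (rule Weierstrass_m_test_general[OF _ assms]) (simp add: norm_mult)

lemma fourier_series_measurable:
  assumes "(\<lambda>k. norm (a k)) summable_on (UNIV :: int set)"
  shows "(\<lambda>x. \<Sum>\<^sub>\<infinity>k. a k * fexp k x) \<in> borel_measurable circle"
proof (rule circle_measurable_continuous, rule uniform_limit_theorem[OF _ uniform_limit_fourier_series[OF assms]])
  show "\<forall>\<^sub>F F in finite_subsets_at_top UNIV. continuous_on UNIV (\<lambda>x. \<Sum>k\<in>F. a k * fexp k x)"
    by (intro always_eventually allI continuous_intros continuous_fexp)
qed simp

lemma norm_fourier_series_le:
  assumes "(\<lambda>k. norm (a k)) summable_on (UNIV :: int set)"
  shows "norm (\<Sum>\<^sub>\<infinity>k. a k * fexp k x) \<le> (\<Sum>\<^sub>\<infinity>k. norm (a k))"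
  using norm_infsum_bound[of "\<lambda>k. a k * fexp k x" UNIV] assms by (simp add: norm_mult)

text \<open>Uniform convergence of the partial sums permits termwise integration against an
  integrable \<open>G\<close>. Integrability is all that \<open>weak_deriv\<close> provides for the
  derivatives of u.\<close>

lemma has_sum_integral_fourier_series:
  fixes G :: "real \<Rightarrow> complex"
  assumes a: "(\<lambda>k. norm (a k)) summable_on (UNIV :: int set)" and G: "integrable circle G"
  shows "((\<lambda>k. a k * (LINT x|circle. fexp k x * G x)) has_sum
            (LINT x|circle. (\<Sum>\<^sub>\<infinity>k. a k * fexp k x) * G x)) UNIV"
  unfolding has_sum_def
proof (rule tendstoI)
  fix e :: real assume "e > 0"
  let ?U = "\<lambda>x. \<Sum>\<^sub>\<infinity>k. a k * fexp k x"
  let ?I = "LINT x|circle. norm (G x)"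
  have I: "?I \<ge> 0" by simp
  \<comment> \<open>The summand 1 keeps the quotient meaningful when \<open>G\<close> vanishes
    almost everywhere.\<close>
  define d where "d = e / (?I + 1)"
  have d: "d > 0" using \<open>e > 0\<close> I by (simp add: d_def add_nonneg_pos)
  have "?I + 1 \<noteq> 0" using I by linarith
  then have "d * (?I + 1) = e" unfolding d_def by (rule nonzero_eq_divide_eq[THEN iffD1]) (rule refl)
  then have dI: "d * ?I < e" using d by (simp add: algebra_simps)
  have "\<forall>\<^sub>F F in finite_subsets_at_top UNIV. \<forall>x\<in>UNIV. dist (\<Sum>k\<in>F. a k * fexp k x) (?U x) < d"
    using uniform_limit_fourier_series[OF a] d by (rule uniform_limitD)
  then show "\<forall>\<^sub>F F in finite_subsets_at_top UNIV.
      dist (\<Sum>k\<in>F. a k * (LINT x|circle. fexp k x * G x)) (LINT x|circle. ?U x * G x) < e"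
  proof (rule eventually_mono)
    fix F assume F: "\<forall>x\<in>UNIV. dist (\<Sum>k\<in>F. a k * fexp k x) (?U x) < d"
    have iU: "integrable circle (\<lambda>x. ?U x * G x)"
      by (rule integrable_circle_mult_bounded, rule G, rule fourier_series_measurable[OF a],
          rule norm_fourier_series_le[OF a])
    have iF: "integrable circle (\<lambda>x. a k * (fexp k x * G x))" for k
      using integrable_circle_mult_fexp[OF G, of k] by (simp add: mult.commute)
    have iS: "integrable circle (\<lambda>x. \<Sum>k\<in>F. a k * (fexp k x * G x))"
      using iF by (intro Bochner_Integration.integrable_sum)
    have "(\<Sum>k\<in>F. a k * (LINT x|circle. fexp k x * G x)) = (LINT x|circle. (\<Sum>k\<in>F. a k * (fexp k x * G x)))"
      using iF by (subst Bochner_Integration.integral_sum) auto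
    then have "dist (\<Sum>k\<in>F. a k * (LINT x|circle. fexp k x * G x)) (LINT x|circle. ?U x * G x)
        = norm (LINT x|circle. (\<Sum>k\<in>F. a k * (fexp k x * G x)) - ?U x * G x)"
      using iU iS by (simp add: dist_norm)
    also have "\<dots> \<le> (LINT x|circle. d * norm (G x))"
    proof (rule Bochner_Integration.integral_norm_bound_integral)
      fix x
      have "(\<Sum>k\<in>F. a k * (fexp k x * G x)) - ?U x * G x = ((\<Sum>k\<in>F. a k * fexp k x) - ?U x) * G x"
        by (simp add: sum_distrib_right left_diff_distrib mult.assoc)
      then show "norm ((\<Sum>k\<in>F. a k * (fexp k x * G x)) - ?U x * G x) \<le> d * norm (G x)"
        using F by (auto simp: norm_mult dist_norm intro!: mult_right_mono intro: less_imp_le)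
    qed (use iS iU G in auto)
    also have "\<dots> < e" using dI by simp
    finally show "dist (\<Sum>k\<in>F. a k * (LINT x|circle. fexp k x * G x)) (LINT x|circle. ?U x * G x) < e" .
  qed
qed

section \<open>Uniqueness of Fourier coefficients\<close>

lemma integral_polynomial_cis_eq_0:
  fixes w :: "real \<Rightarrow> complex"
  assumes "real_polynomial_function p"
    and "integrable circle w" "\<And>k. (LINT x|circle. w x * fexp k x) = 0"
  shows "integrable circle (\<lambda>x. w x * of_real (p (fexp 1 x))) \<and>
    (\<forall>k. (LINT x|circle. w x * of_real (p (fexp 1 x)) * fexp k x) = 0)"
  using assms
proof (induction arbitrary: w rule: real_polynomial_function.induct)
  case (linear f)
  have f: "f z = f 1 * Re z + f \<i> * Im z" for z
  proof -
    have "z = Re z *\<^sub>R 1 + Im z *\<^sub>R \<i>" by (simp add: complex_eq_iff)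
    then have "f z = f (Re z *\<^sub>R 1 + Im z *\<^sub>R \<i>)" by (rule arg_cong)
    then show ?thesis using linear by (simp add: bounded_linear.linear linear_add linear_scale)
  qed
  \<comment> \<open>From Re z = (z + cnj z) / 2 and Im z = (z - cnj z) / (2 i), where cnj z is
    \<open>fexp (- 1) x\<close> for z = \<open>fexp 1 x\<close>.\<close>
  define A where "A = complex_of_real (f 1) / 2 + complex_of_real (f \<i>) / (2 * \<i>)"
  define B where "B = complex_of_real (f 1) / 2 - complex_of_real (f \<i>) / (2 * \<i>)"
  have eq: "complex_of_real (f (fexp 1 x)) = A * fexp 1 x + B * fexp (- 1) x" for x
    unfolding cnj_fexp[symmetric] f[of "fexp 1 x"] A_def B_def
    by (simp add: complex_eq_iff field_simps)
  have e2: "w x * of_real (f (fexp 1 x)) * fexp k x = A * (w x * fexp (k + 1) x) + B * (w x * fexp (k - 1) x)" for x k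
    using fexp_add[of k 1 x] fexp_add[of k "- 1" x] by (simp add: eq algebra_simps)
  have i: "integrable circle (\<lambda>x. w x * fexp k x)" for k
    by (rule integrable_circle_mult_fexp[OF linear(2)])
  have "integrable circle (\<lambda>x. w x * of_real (f (fexp 1 x)))"
    using e2[of _ 0] i[of 1] i[of "-1"] by simp
  moreover have "(LINT x|circle. w x * of_real (f (fexp 1 x)) * fexp k x) = 0" for k
    unfolding e2 using i linear(3) by simp
  ultimately show ?case by blast
next
  case (const c)
  then show ?case by (auto simp: mult.assoc mult.left_commute[of _ "complex_of_real c"])
next
  case (add f g)
  have f: "integrable circle (\<lambda>x. w x * of_real (f (fexp 1 x)))"
      "\<And>k. (LINT x|circle. w x * of_real (f (fexp 1 x)) * fexp k x) = 0"
    and g: "integrable circle (\<lambda>x. w x * of_real (g (fexp 1 x)))"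
      "\<And>k. (LINT x|circle. w x * of_real (g (fexp 1 x)) * fexp k x) = 0"
    using add by blast+
  show ?case
    using f g integrable_circle_mult_fexp[OF f(1)] integrable_circle_mult_fexp[OF g(1)]
    by (simp add: ring_distribs)
next
  \<comment> \<open>This case shapes the statement: the hypothesis for \<open>g\<close> is applied
    to the product of \<open>w\<close> with \<open>f\<close>, which must again be integrable and
    orthogonal to every \<open>fexp k\<close>.\<close>
  case (mult f g)
  have "integrable circle (\<lambda>x. w x * of_real (f (fexp 1 x)))"
      "\<And>k. (LINT x|circle. w x * of_real (f (fexp 1 x)) * fexp k x) = 0"
    using mult by blast+
  from mult.IH(2)[OF this] show ?case by (simp add: mult.assoc)
qed

lemma fexp_1_in_sphere: "fexp 1 x \<in> sphere 0 1"
  by simp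

text \<open>Stone-Weierstrass on the unit circle: \<open>g\<close> is uniformly close to a real
  polynomial, whose integral against \<open>w\<close> vanishes, and the error is at most e times the
  L^1 norm of \<open>w\<close>.\<close>

lemma integral_continuous_cis_eq_0:
  fixes w :: "real \<Rightarrow> complex" and g :: "complex \<Rightarrow> real"
  assumes w: "integrable circle w" "\<And>k. (LINT x|circle. w x * fexp k x) = 0"
    and g: "continuous_on UNIV g"
  shows "integrable circle (\<lambda>x. w x * of_real (g (fexp 1 x)))" (is ?A)
    and "(LINT x|circle. w x * of_real (g (fexp 1 x))) = 0" (is ?B)
proof -
  have cS: "compact (g ` sphere 0 1)"
    by (intro compact_continuous_image continuous_on_subset[OF g]) auto
  then obtain K where K: "\<And>x. \<bar>g (fexp 1 x)\<bar> \<le> K"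
    using compact_imp_bounded[OF cS] fexp_1_in_sphere by (fastforce simp: bounded_iff)
  have "(\<lambda>x. complex_of_real (g (fexp 1 x))) \<in> borel_measurable circle"
    by (intro circle_measurable_continuous continuous_intros continuous_on_compose2[OF g] continuous_fexp) auto
  from integrable_circle_mult_bounded[OF w(1) this, of K] K
  show A: ?A by (simp add: mult.commute)
  let ?I = "LINT x|circle. norm (w x)"
  have "norm (LINT x|circle. w x * of_real (g (fexp 1 x))) \<le> e * ?I" if "e > 0" for e
  proof -
    have "continuous_on (sphere 0 1) g" by (rule continuous_on_subset[OF g]) simp
    then obtain p where p: "real_polynomial_function p" "\<And>z. z \<in> sphere 0 1 \<Longrightarrow> \<bar>g z - p z\<bar> < e"
      using Stone_Weierstrass_real_polynomial_function[OF compact_sphere _ \<open>e > 0\<close>] by blast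
    note ip0 = integral_polynomial_cis_eq_0[OF p(1) w]
    have ip: "integrable circle (\<lambda>x. w x * of_real (p (fexp 1 x)))"
      using ip0 by (rule conjunct1)
    have zp: "(LINT x|circle. w x * of_real (p (fexp 1 x))) = 0"
      using spec[OF conjunct2[OF ip0], of 0] by simp
    have "(LINT x|circle. w x * of_real (g (fexp 1 x)))
        = (LINT x|circle. w x * of_real (g (fexp 1 x)) - w x * of_real (p (fexp 1 x)))"
      using A ip zp by simp
    also have "norm \<dots> \<le> (LINT x|circle. e * norm (w x))"
    proof (rule Bochner_Integration.integral_norm_bound_integral)
      fix x
      have "w x * of_real (g (fexp 1 x)) - w x * of_real (p (fexp 1 x))
        = of_real (g (fexp 1 x) - p (fexp 1 x)) * w x" by (simp add: algebra_simps)
      then show "norm (w x * of_real (g (fexp 1 x)) - w x * of_real (p (fexp 1 x))) \<le> e * norm (w x)"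
        using p(2)[OF fexp_1_in_sphere, of x] by (auto simp: norm_mult simp del: of_real_diff intro!: mult_right_mono)
    qed (use A ip w in auto)
    finally show ?thesis by simp
  qed
  note bd = this
  have "norm (LINT x|circle. w x * of_real (g (fexp 1 x))) \<le> 0"
  proof (rule field_le_epsilon)
    fix e :: real assume "e > 0"
    have "norm (LINT x|circle. w x * of_real (g (fexp 1 x))) \<le> e / (?I + 1) * ?I"
      using \<open>e > 0\<close> by (intro bd divide_pos_pos add_nonneg_pos) auto
    also have "\<dots> \<le> e"
      using \<open>e > 0\<close> by (simp add: divide_le_eq add_nonneg_pos mult_left_mono)
    finally show "norm (LINT x|circle. w x * of_real (g (fexp 1 x))) \<le> 0 + e" by simp
  qed
  then show ?B by simp
qed

lemma inj_on_fexp_1: "inj_on (fexp 1) {0..<1}"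
proof (rule inj_onI)
  fix x y assume xy: "x \<in> {0..<1::real}" "y \<in> {0..<1::real}" and eq: "fexp 1 x = fexp 1 y"
  then have "cis (2 * pi * (x - y)) = 1"
    by (simp add: fexp_def cis_divide[symmetric] right_diff_distrib)
  then have "cos (2 * pi * (x - y)) = 1" by (simp add: complex_eq_iff)
  then obtain n :: int where "2 * pi * (x - y) = of_int n * 2 * pi"
    using cos_one_2pi_int by blast
  then have "x - y = of_int n" by simp
  moreover have "\<bar>x - y\<bar> < 1" using xy by auto
  ultimately have "n = 0" by linarith
  then show "x = y" using \<open>x - y = of_int n\<close> by simp
qed

text \<open>A closed set inside the half-open interval is compact, so its image \<open>C\<close>
  under \<open>fexp 1\<close> is closed in the plane. Its indicator is therefore the pointwise limit
  of continuous cutoffs depending on the distance to \<open>C\<close>, and dominated convergence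
  applies.\<close>

lemma integral_indicator_eq_0:
  fixes w :: "real \<Rightarrow> complex"
  assumes w: "integrable circle w" "\<And>k. (LINT x|circle. w x * fexp k x) = 0"
    and A: "closed A" "A \<subseteq> {0..<1}"
  shows "(LINT x|circle. w x * of_real (indicator A x)) = 0"
proof -
  define C where "C = fexp 1 ` A"
  have "compact A"
    using A bounded_subset[of "{0..<1::real}" A] by (simp add: compact_eq_bounded_closed)
  then have "compact C" unfolding C_def by (intro compact_continuous_image continuous_fexp)
  then have C: "closed C" by (rule compact_imp_closed)
  have memC: "fexp 1 x \<in> C \<longleftrightarrow> x \<in> A" if "x \<in> {0..<1}" for x
    using inj_on_image_mem_iff[OF inj_on_fexp_1 that A(2)] by (simp add: C_def)
  show ?thesis
  proof (cases "A = {}")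
    case False
    then have Cne: "C \<noteq> {}" by (simp add: C_def)
    define g where "g n z = max 0 (1 - real n * infdist z C)" for n z
    have gc: "continuous_on UNIV (g n)" for n
      unfolding g_def by (intro continuous_intros)
    have g01: "0 \<le> g n z" "g n z \<le> 1" for n z
      by (auto simp: g_def infdist_nonneg)
    have lim: "(\<lambda>n. g n (fexp 1 x)) \<longlonglongrightarrow> indicator A x" if "x \<in> {0..<1}" for x
    proof (cases "x \<in> A")
      case True
      then have "fexp 1 x \<in> C" using memC that by blast
      then show ?thesis using True by (simp add: g_def)
    next
      case False
      then have pos: "infdist (fexp 1 x) C > 0"
        using memC[OF that] infdist_pos_not_in_closed[OF C Cne] by auto
      obtain N :: nat where N: "1 / infdist (fexp 1 x) C < real N"
        using reals_Archimedean2 by blast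
      have "g n (fexp 1 x) = 0" if "n \<ge> N" for n
      proof -
        have "1 / infdist (fexp 1 x) C < real n" using N that by linarith
        then show ?thesis using pos by (simp add: g_def field_simps)
      qed
      then show ?thesis using False
        by (intro tendsto_eventually) (auto simp: eventually_sequentially)
    qed
    have "(\<lambda>n. LINT x|circle. w x * of_real (g n (fexp 1 x))) \<longlonglongrightarrow> (LINT x|circle. w x * of_real (indicator A x))"
    proof (rule integral_dominated_convergence[where w = "\<lambda>x. norm (w x)"])
      have "A \<in> sets lebesgue" using A(1) by auto
      then have "A \<in> sets circle" using A(2) by (auto simp: sets_restrict_space)
      then show "(\<lambda>x. w x * complex_of_real (indicator A x)) \<in> borel_measurable circle"
        using w(1) by measurable
      show "(\<lambda>x. w x * complex_of_real (g n (fexp 1 x))) \<in> borel_measurable circle" for n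
        using integral_continuous_cis_eq_0(1)[OF w gc] by (rule borel_measurable_integrable)
      show "integrable circle (\<lambda>x. norm (w x))" using w(1) by simp
      show "AE x in circle. (\<lambda>n. w x * complex_of_real (g n (fexp 1 x))) \<longlonglongrightarrow> w x * complex_of_real (indicator A x)"
        by (rule AE_I2) (auto intro!: tendsto_intros lim simp: space_restrict_space)
      show "AE x in circle. norm (w x * complex_of_real (g n (fexp 1 x))) \<le> norm (w x)" for n
        using g01 by (auto simp: norm_mult mult_left_le)
    qed
    then show ?thesis
      using integral_continuous_cis_eq_0(2)[OF w gc] by (simp add: LIMSEQ_const_iff)
  qed simp
qed

text \<open>The set \<open>P\<close> where the real part is positive is filled by a closed set
  \<open>A\<close> up to measure e. The real part has integral zero over \<open>A\<close> but is
  positive there, so \<open>A\<close> is null and \<open>P\<close> has measure less than e.\<close>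

lemma fourier_uniqueness:
  fixes w :: "real \<Rightarrow> complex"
  assumes w: "integrable circle w" "\<And>k. (LINT x|circle. w x * fexp k x) = 0"
  shows "AE x in circle. w x = 0"
proof -
  have nonpos: "AE x in circle. Re (v x) \<le> 0"
    if v: "integrable circle v" "\<And>k. (LINT x|circle. v x * fexp k x) = 0" for v :: "real \<Rightarrow> complex"
  proof -
    define P where "P = {x \<in> space circle. Re (v x) > 0}"
    have [measurable]: "v \<in> borel_measurable circle" using v by simp
    have P: "P \<in> sets circle" unfolding P_def by measurable
    then have Pl: "P \<in> sets lebesgue" and P01: "P \<subseteq> {0..<1}"
      by (auto simp: sets_restrict_space)
    have "emeasure lebesgue P < ennreal e" if "e > 0" for e
    proof -
      obtain A where A: "closed A" "A \<subseteq> P" "P - A \<in> lmeasurable" "emeasure lebesgue (P - A) < ennreal e"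
        using sets_lebesgue_inner_closed[OF Pl \<open>e > 0\<close>] by blast
      have Al: "A \<in> sets lebesgue" using A(1) by auto
      then have Ac: "A \<in> sets circle" using A(2) P01 by (auto simp: sets_restrict_space)
      have A01: "A \<subseteq> {0..<1}" using A(2) P01 by blast
      have i: "integrable circle (\<lambda>x. v x * of_real (indicator A x))"
        using integrable_mult_indicator[OF Ac v(1)] by (simp add: scaleR_conv_of_real mult.commute)
      have "(LINT x|circle. Re (v x * of_real (indicator A x))) = Re (LINT x|circle. v x * of_real (indicator A x))"
        using i by (rule integral_Re)
      also have "\<dots> = 0" using integral_indicator_eq_0[OF v A(1) A01] by simp
      finally have z: "(LINT x|circle. Re (v x) * indicator A x) = 0" by simp
      have "AE x in circle. Re (v x) * indicator A x = 0"
      proof (subst integral_nonneg_eq_0_iff_AE[symmetric])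
        show "integrable circle (\<lambda>x. Re (v x) * indicator A x)"
          using integrable_Re[OF i] by simp
        show "AE x in circle. 0 \<le> Re (v x) * indicator A x"
          by (rule AE_I2) (use A(2) in \<open>auto simp: P_def indicator_def\<close>)
      qed (rule z)
      then have "AE x in circle. x \<notin> A"
        by eventually_elim (use A(2) in \<open>auto simp: P_def indicator_def split: if_splits\<close>)
      then have "emeasure circle A = 0"
        using Ac by (subst (asm) AE_iff_measurable[where N = A]) (use A01 in \<open>auto simp: space_restrict_space\<close>)
      then have "emeasure lebesgue A = 0"
        using A01 by (subst (asm) emeasure_restrict_space) auto
      moreover have "emeasure lebesgue P \<le> emeasure lebesgue (P - A) + emeasure lebesgue A"
        using emeasure_subadditive[of "P - A" lebesgue A] A(2) Pl Al
        by (simp add: Un_absorb2)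
      ultimately have "emeasure lebesgue P \<le> emeasure lebesgue (P - A)" by simp
      then show ?thesis using A(4) by (rule order_le_less_trans)
    qed
    then have "emeasure lebesgue P \<le> 0 + ennreal e" if "e > 0" for e
      using that by (simp add: order_less_imp_le)
    then have "emeasure lebesgue P \<le> 0" by (rule ennreal_le_epsilon)
    then have "emeasure lebesgue P = 0" by simp
    then have "emeasure circle P = 0"
      using P01 by (subst emeasure_restrict_space) auto
    then show ?thesis
      using P by (subst AE_iff_measurable[where N = P]) (auto simp: P_def not_le)
  qed
  have "AE x in circle. Re (c * w x) \<le> 0" for c
  proof (rule nonpos)
    show "integrable circle (\<lambda>x. c * w x)" using w(1) by simp
    show "(LINT x|circle. c * w x * fexp k x) = 0" for k
      using w(2)[of k] by (simp add: mult.assoc)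
  qed
  \<comment> \<open>The four factors give both signs of the real and of the imaginary part of
    w.\<close>
  from this[of 1] this[of "-1"] this[of \<i>] this[of "-\<i>"] show ?thesis
    by eventually_elim (simp add: complex_eq_iff)
qed

section \<open>Inversion and products\<close>

lemma fourier_inversion:
  assumes f: "integrable circle f" and s: "(\<lambda>k. norm (fourier_coeff f k)) summable_on UNIV"
  shows "AE x in circle. complex_of_real (f x) = (\<Sum>\<^sub>\<infinity>k. fourier_coeff f k * fexp k x)"
proof -
  let ?U = "\<lambda>x. \<Sum>\<^sub>\<infinity>k. fourier_coeff f k * fexp k x"
  have U: "integrable circle ?U"
    by (rule integrable_circle_bounded, rule fourier_series_measurable[OF s], rule norm_fourier_series_le[OF s])
  have cf: "integrable circle (\<lambda>x. complex_of_real (f x))" using f by simp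
  \<comment> \<open>Orthogonality leaves only k = -j, so the series has the same coefficients as
    \<open>f\<close>, and uniqueness applies to the difference.\<close>
  have "(LINT x|circle. ?U x * fexp j x) = fourier_coeff f (- j)" for j
  proof -
    have "((\<lambda>k. fourier_coeff f k * (LINT x|circle. fexp k x * fexp j x)) has_sum (LINT x|circle. ?U x * fexp j x)) UNIV"
      by (rule has_sum_integral_fourier_series[OF s integrable_fexp])
    moreover have "((\<lambda>k. fourier_coeff f k * (LINT x|circle. fexp k x * fexp j x)) has_sum fourier_coeff f (- j)) UNIV"
      by (rule has_sum_finite_neutralI[of "{- j}"])
        (auto simp: fexp_add[symmetric] integral_fexp eq_neg_iff_add_eq_0 simp del: fexp_0)
    ultimately show ?thesis by (rule has_sum_unique)
  qed
  then have "(LINT x|circle. (complex_of_real (f x) - ?U x) * fexp j x) = 0" for j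
    using integrable_circle_mult_fexp[OF U, of j] integrable_circle_mult_fexp[OF cf, of j]
    by (simp add: left_diff_distrib fourier_coeff_fexp)
  from fourier_uniqueness[OF _ this] U cf show ?thesis by simp
qed

text \<open>The factor \<open>f\<close> is replaced almost everywhere by its bounded Fourier series,
  and termwise integration against \<open>g\<close> produces the convolution. In the application
  \<open>f\<close> is u and \<open>g\<close> is m_x.\<close>

lemma has_sum_fourier_coeff_mult:
  assumes f: "integrable circle f" and s: "(\<lambda>k. norm (fourier_coeff f k)) summable_on UNIV"
    and g: "integrable circle g"
  shows "integrable circle (\<lambda>x. f x * g x)"
    and "((\<lambda>j. fourier_coeff f (k - j) * fourier_coeff g j) has_sum fourier_coeff (\<lambda>x. f x * g x) k) UNIV"
proof -
  let ?U = "\<lambda>x. \<Sum>\<^sub>\<infinity>k. fourier_coeff f k * fexp k x"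
  let ?G = "\<lambda>x. complex_of_real (g x)"
  note inv = fourier_inversion[OF f s]
  have cg: "integrable circle ?G" using g by simp
  have iU: "integrable circle (\<lambda>x. ?U x * ?G x)"
    by (rule integrable_circle_mult_bounded, rule cg, rule fourier_series_measurable[OF s],
        rule norm_fourier_series_le[OF s])
  have "integrable circle (\<lambda>x. Re (?U x * ?G x))"
    using iU by (rule integrable_Re)
  moreover have "AE x in circle. Re (?U x * ?G x) = f x * g x"
    using inv by eventually_elim (metis Re_complex_of_real of_real_mult)
  moreover have "(\<lambda>x. f x * g x) \<in> borel_measurable circle" using f g by measurable
  ultimately show "integrable circle (\<lambda>x. f x * g x)"
    by (subst integrable_cong_AE[where g = "\<lambda>x. Re (?U x * ?G x)"]) (auto elim: eventually_mono)
  have "((\<lambda>l. fourier_coeff f l * (LINT x|circle. fexp l x * (?G x * fexp (- k) x))) has_sum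
      (LINT x|circle. ?U x * (?G x * fexp (- k) x))) UNIV"
    by (rule has_sum_integral_fourier_series[OF s integrable_circle_mult_fexp[OF cg]])
  also have "(LINT x|circle. ?U x * (?G x * fexp (- k) x)) = fourier_coeff (\<lambda>x. f x * g x) k"
    unfolding fourier_coeff_fexp[of "\<lambda>x. f x * g x"]
  proof (rule integral_cong_AE)
    show "(\<lambda>x. ?U x * (?G x * fexp (- k) x)) \<in> borel_measurable circle"
      using fourier_series_measurable[OF s] g by measurable
    show "(\<lambda>x. complex_of_real (f x * g x) * fexp (- k) x) \<in> borel_measurable circle"
      using f g by measurable
    show "AE x in circle. ?U x * (?G x * fexp (- k) x) = complex_of_real (f x * g x) * fexp (- k) x"
      using inv by eventually_elim simp
  qed
  also have "(\<lambda>l. fourier_coeff f l * (LINT x|circle. fexp l x * (?G x * fexp (- k) x)))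
      = (\<lambda>l. fourier_coeff f l * fourier_coeff g (k - l))"
  proof
    fix l
    have "fexp (- (k - l)) x = fexp l x * fexp (- k) x" for x
      using fexp_add[of l "- k" x] by simp
    then show "fourier_coeff f l * (LINT x|circle. fexp l x * (?G x * fexp (- k) x))
        = fourier_coeff f l * fourier_coeff g (k - l)"
      unfolding fourier_coeff_fexp[of g] by (simp only: mult.left_commute)
  qed
  finally show "((\<lambda>j. fourier_coeff f (k - j) * fourier_coeff g j) has_sum fourier_coeff (\<lambda>x. f x * g x) k) UNIV"
    by (subst has_sum_reindex_bij_witness[of _ "\<lambda>l. k - l" "\<lambda>j. k - j"]) auto
qed

section \<open>Weak derivatives on the Fourier side\<close>

lemma deriv_funpow_cos:
  "(deriv ^^ n) (\<lambda>x::real. C * cos (w * x + p)) = (\<lambda>x. C * w ^ n * cos (w * x + p + of_nat n * pi / 2))"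
proof (induction n)
  case (Suc n)
  have "deriv (\<lambda>x. C * w ^ n * cos (w * x + p + of_nat n * pi / 2)) x
      = C * w ^ Suc n * cos (w * x + p + of_nat (Suc n) * pi / 2)" for x
  proof (rule DERIV_imp_deriv)
    have "((\<lambda>x. C * w ^ n * cos (w * x + p + of_nat n * pi / 2)) has_real_derivative
        C * w ^ n * (- sin (w * x + p + of_nat n * pi / 2) * w)) (at x)"
      by (auto intro!: derivative_eq_intros)
    also have "- sin (w * x + p + of_nat n * pi / 2) = cos (w * x + p + of_nat n * pi / 2 + pi / 2)"
      by (simp add: cos_add)
    also have "w * x + p + of_nat n * pi / 2 + pi / 2 = w * x + p + of_nat (Suc n) * pi / 2"
      by (simp add: field_simps)
    finally show "((\<lambda>x. C * w ^ n * cos (w * x + p + of_nat n * pi / 2)) has_real_derivative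
        C * w ^ Suc n * cos (w * x + p + of_nat (Suc n) * pi / 2)) (at x)"
      by (simp add: mult_ac)
  qed
  then show ?case using Suc.IH by simp
qed simp

lemma smooth_periodic_cos: "smooth_periodic (\<lambda>x. cos (2 * pi * of_int k * x + p))"
  unfolding smooth_periodic_def
proof (intro conjI allI)
  show "periodic1 (\<lambda>x. cos (2 * pi * of_int k * x + p))"
    unfolding periodic1_def
  proof
    fix x
    have "2 * pi * of_int k * (x + 1) + p = 2 * pi * of_int k * x + p + 2 * pi * of_int k"
      by (simp add: algebra_simps)
    then have "cos (2 * pi * of_int k * (x + 1) + p) = cos (2 * pi * of_int k * x + p + 2 * pi * of_int k)"
      by (rule arg_cong)
    also have "\<dots> = cos (2 * pi * of_int k * x + p)"
      unfolding cos_add[of "2 * pi * of_int k * x + p"] by simp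
    finally show "cos (2 * pi * of_int k * (x + 1) + p) = cos (2 * pi * of_int k * x + p)" .
  qed
  show "(deriv ^^ n) (\<lambda>x. cos (2 * pi * of_int k * x + p)) differentiable at x" for n x
  proof -
    have "((\<lambda>x. cos (2 * pi * of_int k * x + p + of_nat n * pi / 2)) has_real_derivative
        - sin (2 * pi * of_int k * x + p + of_nat n * pi / 2) * (2 * pi * of_int k)) (at x)"
      by (auto intro!: derivative_eq_intros)
    then have "(\<lambda>x. cos (2 * pi * of_int k * x + p + of_nat n * pi / 2)) differentiable at x"
      using real_differentiable_def by blast
    then show ?thesis
      using deriv_funpow_cos[of n 1 "2 * pi * of_int k" p] by simp
  qed
qed

text \<open>Test functions are real, so the character is assembled from two cosines whose phases
  differ by pi / 2. Each derivative shifts the phase by pi / 2, which turns into a factor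
  \<i>.\<close>

lemma fourier_coeff_weak_deriv:
  assumes "weak_deriv n f g"
  shows "fourier_coeff g k = (2 * pi * \<i> * of_int k) ^ n * fourier_coeff f k"
proof -
  define w where "w = 2 * pi * of_int (- k)"
  have f: "integrable circle f" and g: "integrable circle g"
    using assms by (auto simp: weak_deriv_def)
  have cosi: "integrable circle (\<lambda>x. h x * cos (w * x + p))" if "integrable circle h" for h p
  proof (rule Bochner_Integration.integrable_bound)
    show "integrable circle h" by fact
    have "(\<lambda>x. cos (w * x + p)) \<in> borel_measurable circle"
      by (intro circle_measurable_continuous continuous_intros)
    then show "(\<lambda>x. h x * cos (w * x + p)) \<in> borel_measurable circle"
      using that by measurable
    show "AE x in circle. norm (h x * cos (w * x + p)) \<le> norm (h x)"
      by (auto simp: abs_mult mult_left_le)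
  qed
  have wd: "(LINT x|circle. g x * cos (w * x + p)) =
      (- w) ^ n * (LINT x|circle. f x * cos (w * x + p + of_nat n * pi / 2))" for p
  proof -
    have "(LINT x|circle. f x * (deriv ^^ n) (\<lambda>x. cos (w * x + p)) x)
        = (-1) ^ n * (LINT x|circle. g x * cos (w * x + p))"
      using assms smooth_periodic_cos[of "- k" p] by (auto simp: weak_deriv_def w_def)
    moreover have "(LINT x|circle. f x * (deriv ^^ n) (\<lambda>x. cos (w * x + p)) x)
        = w ^ n * (LINT x|circle. f x * cos (w * x + p + of_nat n * pi / 2))"
    proof -
      have "f x * (deriv ^^ n) (\<lambda>x. cos (w * x + p)) x = w ^ n * (f x * cos (w * x + p + of_nat n * pi / 2))" for x
        using deriv_funpow_cos[of n 1 w p] by simp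
      then show ?thesis by (simp only: integral_mult_right_zero)
    qed
    ultimately have "(-1) ^ n * ((-1) ^ n * (LINT x|circle. g x * cos (w * x + p)))
        = (-1) ^ n * (w ^ n * (LINT x|circle. f x * cos (w * x + p + of_nat n * pi / 2)))"
      by simp
    then show ?thesis
      by (simp add: mult.assoc[symmetric] power_mult_distrib[symmetric])
  qed
  have split: "(LINT x|circle. complex_of_real (h x) * cis (w * x + p)) =
      of_real (LINT x|circle. h x * cos (w * x + p)) + \<i> * of_real (LINT x|circle. h x * cos (w * x + (p - pi / 2)))"
    if h: "integrable circle h" for h p
  proof -
    have e: "complex_of_real (h x) * cis (w * x + p) =
        of_real (h x * cos (w * x + p)) + \<i> * of_real (h x * cos (w * x + (p - pi / 2)))" for x
      by (simp add: complex_eq_iff cos_diff add_diff_eq)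
    have "(LINT x|circle. complex_of_real (h x) * cis (w * x + p))
      = (LINT x|circle. complex_of_real (h x * cos (w * x + p))) +
        (LINT x|circle. \<i> * complex_of_real (h x * cos (w * x + (p - pi / 2))))"
      unfolding e using cosi[OF h, of p] cosi[OF h, of "p - pi / 2"]
      by (intro Bochner_Integration.integral_add integrable_mult_right integrable_of_real)
    then show ?thesis by (simp del: of_real_mult)
  qed
  have "fourier_coeff g k = (LINT x|circle. complex_of_real (g x) * cis (w * x + 0))"
    by (simp add: fourier_coeff_def w_def)
  also have "\<dots> = of_real ((- w) ^ n) * (LINT x|circle. complex_of_real (f x) * cis (w * x + of_nat n * pi / 2))"
    unfolding split[OF g] split[OF f] wd by (simp add: algebra_simps)
  also have "(\<lambda>x. complex_of_real (f x) * cis (w * x + of_nat n * pi / 2))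
      = (\<lambda>x. complex_of_real (f x) * cis (w * x) * \<i> ^ n)"
  proof -
    have "cis (of_nat n * pi / 2) = \<i> ^ n"
      using Complex.DeMoivre[of "pi / 2" n] by simp
    then show ?thesis by (simp add: cis_mult[symmetric] mult.assoc)
  qed
  also have "of_real ((- w) ^ n) * (LINT x|circle. complex_of_real (f x) * cis (w * x) * \<i> ^ n)
     = (2 * pi * \<i> * of_int k) ^ n * fourier_coeff f k"
    by (simp add: fourier_coeff_def w_def power_mult_distrib mult_ac)
  finally show ?thesis .
qed

section \<open>Quadratic forms of trigonometric polynomials\<close>

lemma fourier_coeff_cnj: "cnj (fourier_coeff f k) = fourier_coeff f (- k)"
  unfolding fourier_coeff_fexp by (simp add: Bochner_Integration.integral_cnj[symmetric] cnj_fexp)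

lemma integral_norm_trig_poly:
  assumes F: "finite F"
  shows "(LINT x|circle. (norm (\<Sum>j\<in>F. r j * fexp j x))\<^sup>2) = (\<Sum>j\<in>F. (norm (r j))\<^sup>2)"
proof -
  have i: "integrable circle (\<lambda>x. r j * cnj (r k) * fexp (j - k) x)" for j k
    using integrable_fexp by simp
  have "complex_of_real ((norm (\<Sum>j\<in>F. r j * fexp j x))\<^sup>2)
      = (\<Sum>j\<in>F. \<Sum>k\<in>F. r j * cnj (r k) * fexp (j - k) x)" for x
    unfolding complex_norm_square cnj_sum sum_product
    by (intro sum.cong refl) (simp add: fexp_diff mult_ac)
  then have "complex_of_real (LINT x|circle. (norm (\<Sum>j\<in>F. r j * fexp j x))\<^sup>2)
      = (LINT x|circle. (\<Sum>j\<in>F. \<Sum>k\<in>F. r j * cnj (r k) * fexp (j - k) x))"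
    by (subst integral_complex_of_real[symmetric]) simp
  also have "\<dots> = (\<Sum>j\<in>F. \<Sum>k\<in>F. r j * cnj (r k) * (LINT x|circle. fexp (j - k) x))"
    using i by (simp add: Bochner_Integration.integral_sum)
  also have "\<dots> = (\<Sum>j\<in>F. \<Sum>k\<in>F. if j = k then r j * cnj (r k) else 0)"
    by (intro sum.cong refl) (simp add: integral_fexp)
  also have "\<dots> = (\<Sum>j\<in>F. r j * cnj (r j))"
    using F by simp
  also have "\<dots> = complex_of_real (\<Sum>j\<in>F. (norm (r j))\<^sup>2)"
    by (simp only: of_real_sum complex_norm_square)
  finally show ?thesis by (simp only: of_real_eq_iff)
qed

text \<open>The double sum is the integral of g R cnj Q for the trigonometric polynomials R and Q
  with coefficients \<open>r\<close> and \<open>q\<close>; then 2 |R Q| <= |R|^2 + |Q|^2 and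
  orthonormality finish. Through this form the pointwise bound on u_x reaches the Fourier
  side.\<close>

lemma toeplitz_bound:
  assumes g: "integrable circle g" and M: "AE x in circle. \<bar>g x\<bar> \<le> M" and F: "finite F"
  shows "norm (\<Sum>k\<in>F. \<Sum>j\<in>F. fourier_coeff g (k - j) * r j * cnj (q k))
           \<le> M / 2 * ((\<Sum>j\<in>F. (norm (r j))\<^sup>2) + (\<Sum>k\<in>F. (norm (q k))\<^sup>2))"
proof -
  let ?R = "\<lambda>x. \<Sum>j\<in>F. r j * fexp j x" and ?Q = "\<lambda>x. \<Sum>k\<in>F. q k * fexp k x"
  have gi: "integrable circle (\<lambda>x. complex_of_real (g x) * fexp l x)" for l
    using g by (intro integrable_circle_mult_fexp) simp
  have eq: "(\<Sum>k\<in>F. \<Sum>j\<in>F. r j * cnj (q k) * (complex_of_real (g x) * fexp (- (k - j)) x))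
      = complex_of_real (g x) * (?R x * cnj (?Q x))" for x
  proof -
    have "?R x * cnj (?Q x) = (\<Sum>k\<in>F. \<Sum>j\<in>F. r j * fexp j x * cnj (q k * fexp k x))"
      unfolding cnj_sum sum_product by (rule sum.swap)
    moreover have "fexp (- (k - j)) x = fexp j x * cnj (fexp k x)" for j k
      using fexp_diff[of j k x] by simp
    ultimately show ?thesis
      by (simp add: sum_distrib_left mult_ac)
  qed
  have iR: "integrable circle (\<lambda>x. (norm (\<Sum>j\<in>F. r j * fexp j x))\<^sup>2)" for r
  proof -
    have "integrable circle (\<lambda>x. complex_of_real ((norm (\<Sum>j\<in>F. r j * fexp j x))\<^sup>2))"
    proof (rule integrable_circle_bounded)
      show "(\<lambda>x. complex_of_real ((norm (\<Sum>j\<in>F. r j * fexp j x))\<^sup>2)) \<in> borel_measurable circle"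
        by measurable
      fix x
      have "norm (\<Sum>j\<in>F. r j * fexp j x) \<le> (\<Sum>j\<in>F. norm (r j))"
        by (rule order_trans[OF norm_sum]) (simp add: norm_mult)
      then show "norm (complex_of_real ((norm (\<Sum>j\<in>F. r j * fexp j x))\<^sup>2)) \<le> (\<Sum>j\<in>F. norm (r j))\<^sup>2"
        by (simp add: power_mono norm_power)
    qed
    from integrable_Re[OF this] show ?thesis by simp
  qed
  have "(\<Sum>k\<in>F. \<Sum>j\<in>F. fourier_coeff g (k - j) * r j * cnj (q k))
      = (\<Sum>k\<in>F. \<Sum>j\<in>F. r j * cnj (q k) * (LINT x|circle. complex_of_real (g x) * fexp (- (k - j)) x))"
    by (intro sum.cong refl) (simp add: fourier_coeff_fexp)
  also have "\<dots> = (LINT x|circle. (\<Sum>k\<in>F. \<Sum>j\<in>F. r j * cnj (q k) * (complex_of_real (g x) * fexp (- (k - j)) x)))"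
    using gi by (simp add: Bochner_Integration.integral_sum del: minus_diff_eq)
  also have "norm \<dots> \<le> (LINT x|circle. M / 2 * ((norm (?R x))\<^sup>2 + (norm (?Q x))\<^sup>2))"
  proof (rule order_trans[OF integral_norm_bound integral_mono_AE])
    show "integrable circle (\<lambda>x. norm (\<Sum>k\<in>F. \<Sum>j\<in>F. r j * cnj (q k) * (complex_of_real (g x) * fexp (- (k - j)) x)))"
      using gi by (intro integrable_norm Bochner_Integration.integrable_sum integrable_mult_right)
    show "integrable circle (\<lambda>x. M / 2 * ((norm (?R x))\<^sup>2 + (norm (?Q x))\<^sup>2))"
      by (intro integrable_mult_right Bochner_Integration.integrable_add iR)
    show "AE x in circle. norm (\<Sum>k\<in>F. \<Sum>j\<in>F. r j * cnj (q k) * (complex_of_real (g x) * fexp (- (k - j)) x))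
        \<le> M / 2 * ((norm (?R x))\<^sup>2 + (norm (?Q x))\<^sup>2)"
      using M
    proof eventually_elim
      case (elim x)
      have "norm (complex_of_real (g x) * (?R x * cnj (?Q x))) \<le> M * (norm (?R x) * norm (?Q x))"
        unfolding norm_mult complex_mod_cnj using elim by (auto intro!: mult_right_mono simp del: cnj_sum)
      also have "\<dots> \<le> M * (((norm (?R x))\<^sup>2 + (norm (?Q x))\<^sup>2) / 2)"
        using elim sum_squares_bound[of "norm (?R x)" "norm (?Q x)"]
        by (intro mult_left_mono) auto
      finally show ?case unfolding eq by simp
    qed
  qed
  also have "\<dots> = M / 2 * ((\<Sum>j\<in>F. (norm (r j))\<^sup>2) + (\<Sum>k\<in>F. (norm (q k))\<^sup>2))"
    using iR integral_norm_trig_poly[OF F] by simp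
  finally show ?thesis .
qed

section \<open>The energy estimate at a fixed time\<close>

text \<open>The Fourier symbol of \<open>1 - d\<^sup>2/dx\<^sup>2\<close>, so that \<open>symb k * a k\<close> are the coefficients of \<open>m\<close>.\<close>

definition symb :: "int \<Rightarrow> real" where
  "symb k = 1 + (2 * pi * of_int k)\<^sup>2"

lemma symb_ge_1: "symb k \<ge> 1"
  by (simp add: symb_def)

lemma symb_pos [simp]: "symb k > 0"
  using symb_ge_1[of k] by linarith

lemma abs_symb [simp]: "\<bar>symb k\<bar> = symb k" and symb_nonneg [simp]: "0 \<le> symb k" and symb_neq_0 [simp]: "symb k \<noteq> 0"
  using symb_pos[of k] by linarith+

text \<open>Comparison with the sum of 1 / n^2. It makes the coefficients of an H^3 function
  absolutely summable, even after multiplication by \<open>symb\<close>.\<close>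

lemma summable_inverse_symb: "(\<lambda>k. 1 / symb k) summable_on UNIV"
proof -
  have n: "summable (\<lambda>n. 1 / symb (int n))"
  proof (rule summable_comparison_test')
    show "summable (\<lambda>n. inverse (real n ^ 2))" by (rule inverse_power_summable) simp
    fix n :: nat assume "n \<ge> 1"
    have "real n \<le> 2 * pi * real n"
      using mult_right_mono[of 1 "2 * pi" "real n"] pi_gt3 by simp
    then have "real n ^ 2 \<le> (2 * pi * real n)\<^sup>2"
      by (rule power_mono) simp
    then have "real n ^ 2 \<le> symb (int n)" unfolding symb_def of_int_of_nat_eq by linarith
    then have "inverse (symb (int n)) \<le> inverse (real n ^ 2)"
      using \<open>n \<ge> 1\<close> by (intro le_imp_inverse_le) auto
    then show "norm (1 / symb (int n)) \<le> inverse (real n ^ 2)"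
      by (simp add: less_imp_le inverse_eq_divide)
  qed
  have s: "(\<lambda>n. 1 / symb (int n)) summable_on UNIV"
    by (rule summable_nonneg_imp_summable_on[OF n]) (simp add: less_imp_le)
  have "(\<lambda>k. 1 / symb k) summable_on range int"
    using s by (subst summable_on_reindex) (auto simp: o_def)
  moreover have "(\<lambda>k. 1 / symb k) summable_on range (\<lambda>n. - int n)"
    using s by (subst summable_on_reindex) (auto simp: o_def inj_on_def symb_def)
  ultimately have "(\<lambda>k. 1 / symb k) summable_on (range int \<union> range (\<lambda>n. - int n))"
    by (rule summable_on_union)
  moreover have "range int \<union> range (\<lambda>n. - int n) = UNIV"
    by (auto simp: image_iff) (metis int_cases2)
  ultimately show ?thesis by simp
qed

lemma norm_fexp_minus_1_le: "norm (fexp k h - 1) \<le> \<bar>2 * pi * of_int k * h\<bar>"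
proof -
  have "norm (fexp k h - 1) = 2 * \<bar>sin (2 * pi * of_int k * h / 2)\<bar>"
    using dist_exp_i_1[of "2 * pi * of_int k * h"] by (simp add: fexp_def cis_conv_exp)
  also have "\<dots> \<le> 2 * \<bar>2 * pi * of_int k * h / 2\<bar>"
    by (intro mult_left_mono abs_sin_x_le_abs_x) simp
  finally show ?thesis by (simp add: abs_mult)
qed

lemma fexp_has_vector_derivative:
  "(fexp k has_vector_derivative 2 * pi * \<i> * of_int k * fexp k s) (at s within S)"
proof -
  have e: "fexp k = (\<lambda>s. exp (2 * pi * \<i> * of_int k * complex_of_real s))"
    by (simp add: fexp_def[abs_def] cis_conv_exp mult_ac)
  have "((\<lambda>z. exp (2 * pi * \<i> * of_int k * z)) has_field_derivative
      2 * pi * \<i> * of_int k * exp (2 * pi * \<i> * of_int k * complex_of_real s)) (at (complex_of_real s))"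
    by (auto intro!: derivative_eq_intros)
  then show ?thesis unfolding e by (rule has_vector_derivative_real_field)
qed

text \<open>
  Since \<open>fexp k h - 1 = (fexp (k - j) h - 1) * fexp j h + (fexp j h - 1)\<close>, the form splits in two. The
  last summand contributes, after symmetrization, a Toeplitz form of \<open>g\<close>; in the first one
  \<open>(fexp l h - 1) * a l\<close> is the integral over \<open>s \<in> {0..h}\<close> of the \<open>l\<close>-th Fourier coefficient of \<open>g (x + s)\<close>.
\<close>

lemma finite_energy_bound:
  fixes a m n :: "int \<Rightarrow> complex"
  assumes g: "integrable circle g" and M: "AE x in circle. \<bar>g x\<bar> \<le> M" and M0: "0 \<le> M"
    and ga: "\<And>k. fourier_coeff g k = 2 * pi * \<i> * of_int k * a k"
    and a: "\<And>k. a (- k) = cnj (a k)"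
    and n: "\<And>k. n k = 2 * pi * \<i> * of_int k * m k"
    and h: "0 < h" and F: "finite F"
  shows "\<bar>Re (\<Sum>k\<in>F. \<Sum>j\<in>F. (norm (fexp k h - 1))\<^sup>2 * (a (k - j) * n j) * cnj (m k))\<bar>
           \<le> 3 / 2 * M * h\<^sup>2 * (\<Sum>k\<in>F. (norm (n k))\<^sup>2)"
proof -
  \<comment> \<open>Up to truncation to \<open>F\<close>, \<open>q\<close> holds the coefficients of
    m(x + h) - m(x) and \<open>r\<close> those of m_x(x + h). \<open>S1\<close> carries the
    increment u(x + h) - u(x); in \<open>S2\<close> the derivative falls on
    \<open>q\<close>.\<close>
  define d where "d k = fexp k h - 1" for k
  define q where "q k = d k * m k" for k
  define r where "r j = fexp j h * n j" for j
  let ?N = "\<Sum>k\<in>F. (norm (n k))\<^sup>2"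
  define S1 where "S1 = (\<Sum>k\<in>F. \<Sum>j\<in>F. d (k - j) * a (k - j) * r j * cnj (q k))"
  define S2 where "S2 = (\<Sum>k\<in>F. \<Sum>j\<in>F. a (k - j) * (2 * pi * \<i> * of_int j) * q j * cnj (q k))"
  have "(norm (fexp k h - 1))\<^sup>2 * (a (k - j) * n j) * cnj (m k)
      = d (k - j) * a (k - j) * r j * cnj (q k) + a (k - j) * (2 * pi * \<i> * of_int j) * q j * cnj (q k)" for k j
  proof -
    have "complex_of_real ((norm (fexp k h - 1))\<^sup>2) * (a (k - j) * n j) * cnj (m k) = d k * a (k - j) * n j * cnj (q k)"
      unfolding complex_norm_square by (simp add: d_def q_def mult_ac)
    also have "d k = d (k - j) * fexp j h + d j"
      using fexp_add[of "k - j" j h] by (simp add: d_def algebra_simps)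
    finally show ?thesis by (simp add: r_def q_def n algebra_simps)
  qed
  then have S: "(\<Sum>k\<in>F. \<Sum>j\<in>F. (norm (fexp k h - 1))\<^sup>2 * (a (k - j) * n j) * cnj (m k)) = S1 + S2"
    by (simp add: S1_def S2_def sum.distrib)
  \<comment> \<open>An increment of m is bounded by h times its derivative, frequency by
    frequency.\<close>
  have qn: "norm (q k) \<le> h * norm (n k)" for k
  proof -
    have "norm (q k) \<le> \<bar>2 * pi * of_int k * h\<bar> * norm (m k)"
      unfolding q_def norm_mult d_def by (intro mult_right_mono norm_fexp_minus_1_le) simp
    also have "\<dots> = h * norm (n k)"
      using h by (simp add: n norm_mult abs_mult)
    finally show ?thesis .
  qed
  then have "(norm (q k))\<^sup>2 \<le> h\<^sup>2 * (norm (n k))\<^sup>2" for k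
    by (metis norm_ge_zero power_mono power_mult_distrib)
  then have qN: "(\<Sum>k\<in>F. (norm (q k))\<^sup>2) \<le> h\<^sup>2 * ?N"
    by (simp add: sum_distrib_left sum_mono)
  have S2_bound: "\<bar>Re S2\<bar> \<le> 1 / 2 * M * h\<^sup>2 * ?N"
  proof -
    have "cnj S2 = (\<Sum>k\<in>F. \<Sum>j\<in>F. a (j - k) * (- (2 * pi * \<i> * of_int j)) * cnj (q j) * q k)"
      unfolding S2_def cnj_sum using a[symmetric] by (simp add: a[symmetric])
    also have "\<dots> = (\<Sum>k\<in>F. \<Sum>j\<in>F. a (k - j) * (- (2 * pi * \<i> * of_int k)) * q j * cnj (q k))"
      by (subst sum.swap) (simp add: mult_ac)
    finally have cS2: "cnj S2 = \<dots>" .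
    \<comment> \<open>Integration by parts: after exchanging j and k the two frequency factors
      combine to j - k, so the derivative has moved from \<open>q\<close> to u.\<close>
    have "S2 + cnj S2 = - (\<Sum>k\<in>F. \<Sum>j\<in>F. fourier_coeff g (k - j) * q j * cnj (q k))"
      unfolding cS2 unfolding S2_def sum.distrib[symmetric] sum_negf[symmetric]
      by (intro sum.cong refl) (simp add: ga algebra_simps)
    then have "norm (S2 + cnj S2) \<le> M / 2 * ((\<Sum>k\<in>F. (norm (q k))\<^sup>2) + (\<Sum>k\<in>F. (norm (q k))\<^sup>2))"
      using toeplitz_bound[OF g M F, of q q] by simp
    also have "\<dots> \<le> M / 2 * (h\<^sup>2 * ?N + h\<^sup>2 * ?N)"
      using qN M0 by (intro mult_left_mono add_mono) auto
    finally have "norm (S2 + cnj S2) \<le> M * h\<^sup>2 * ?N" by (simp add: algebra_simps)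
    moreover have "\<bar>2 * Re S2\<bar> \<le> norm (S2 + cnj S2)"
      using abs_Re_le_cmod[of "S2 + cnj S2"] by simp
    ultimately show ?thesis by simp
  qed
  have S1_bound: "norm S1 \<le> M * h\<^sup>2 * ?N"
  proof -
    \<comment> \<open>\<open>H h\<close> is \<open>S1\<close> divided by h. Scaling \<open>q\<close>
      by 1 / h balances the Toeplitz form: both of its arguments then have squared norm at most
      \<open>?N\<close>. The derivative \<open>H'\<close> is such a form of \<open>g\<close>,
      because translation only multiplies the arguments by numbers of modulus 1.\<close>
    define H where "H s = (\<Sum>k\<in>F. \<Sum>j\<in>F. (fexp (k - j) s - 1) * a (k - j) * r j * cnj (q k / h))" for s
    define H' where "H' s = (\<Sum>k\<in>F. \<Sum>j\<in>F. (2 * pi * \<i> * of_int (k - j) * fexp (k - j) s) * a (k - j) * r j * cnj (q k / h))" for s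
    have "((\<lambda>s. fexp l s - 1) has_vector_derivative 2 * pi * \<i> * of_int l * fexp l s) (at s)" for l s
      using has_vector_derivative_diff[OF fexp_has_vector_derivative has_vector_derivative_const] by simp
    then have "(H has_vector_derivative H' s) (at s)" for s
      unfolding H_def H'_def
      by (intro has_vector_derivative_sum has_vector_derivative_mult_left)
    note dH = this[unfolded has_vector_derivative_def]
    have bH: "norm (H' s) \<le> M * ?N" for s
    proof -
      have "H' s = (\<Sum>k\<in>F. \<Sum>j\<in>F. fourier_coeff g (k - j) * (fexp (- j) s * r j) * cnj (fexp (- k) s * (q k / h)))"
        unfolding H'_def
      proof (intro sum.cong refl)
        fix k j
        show "(2 * pi * \<i> * of_int (k - j) * fexp (k - j) s) * a (k - j) * r j * cnj (q k / h)
          = fourier_coeff g (k - j) * (fexp (- j) s * r j) * cnj (fexp (- k) s * (q k / h))"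
          using fexp_add[of k "- j" s] by (simp add: ga cnj_fexp)
      qed
      also have "norm \<dots> \<le> M / 2 * ((\<Sum>j\<in>F. (norm (fexp (- j) s * r j))\<^sup>2) + (\<Sum>k\<in>F. (norm (fexp (- k) s * (q k / h)))\<^sup>2))"
        by (rule toeplitz_bound[OF g M F])
      also have "\<dots> = M / 2 * (?N + (\<Sum>k\<in>F. (norm (q k))\<^sup>2) / h\<^sup>2)"
        by (simp add: norm_mult norm_divide r_def power_divide sum_divide_distrib)
      also have "\<dots> \<le> M / 2 * (?N + ?N)"
        using qN h M0 by (intro mult_left_mono add_mono) (auto simp: divide_le_eq mult.commute)
      finally show ?thesis by simp
    qed
    \<comment> \<open>The mean value inequality stands in for the integral over s.\<close>
    have "\<exists>s\<in>{0<..<h}. norm (H h - H 0) \<le> norm ((h - 0) *\<^sub>R H' s)"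
      using dH by (intro mvt_general[OF h, where f' = "\<lambda>s t. t *\<^sub>R H' s"] has_derivative_continuous_on)
        (auto intro: has_derivative_at_withinI)
    then obtain s where "norm (H h - H 0) \<le> norm ((h - 0) *\<^sub>R H' s)" by blast
    moreover have "H 0 = 0" by (simp add: H_def fexp_def)
    ultimately have "norm (H h) \<le> h * (M * ?N)"
      using bH[of s] h by (simp add: order_trans mult_left_mono)
    moreover have "S1 = of_real h * H h"
      using h unfolding S1_def H_def sum_distrib_left d_def by (intro sum.cong refl) simp
    ultimately have "norm S1 \<le> h * (h * (M * ?N))"
      using h by (simp add: norm_mult)
    then show ?thesis by (simp add: power2_eq_square mult_ac)
  qed
  have "\<bar>Re (S1 + S2)\<bar> \<le> norm S1 + \<bar>Re S2\<bar>"
    using abs_Re_le_cmod[of S1] by simp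
  then show ?thesis
    unfolding S using S1_bound S2_bound by simp
qed

section \<open>From finite truncations to the full series\<close>

lemma summable_symb_power:
  fixes a :: "int \<Rightarrow> complex"
  assumes A: "(\<lambda>k. symb k ^ 3 * (norm (a k))\<^sup>2) summable_on UNIV"
  shows "(\<lambda>k. norm (symb k * a k)) summable_on UNIV" and "(\<lambda>k. norm (a k)) summable_on UNIV"
proof -
  \<comment> \<open>With t = \<open>symb k * norm (a k)\<close> this is t <= symb k * t^2 + 1 / symb
    k, a weak form of the inequality of arithmetic and geometric means; the first term is the H^3
    summand.\<close>
  have le: "norm (symb k * a k) \<le> symb k ^ 3 * (norm (a k))\<^sup>2 + 1 / symb k" for k
  proof -
    let ?t = "symb k * norm (a k)"
    have "2 * ?t * symb k \<le> (symb k * ?t)\<^sup>2 + 1"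
      using sum_squares_bound[of "symb k * ?t" 1] by (simp add: mult_ac)
    moreover have "0 \<le> ?t * symb k" using symb_pos[of k] by (simp add: less_imp_le)
    ultimately have "?t * symb k \<le> (symb k * ?t)\<^sup>2 + 1" by linarith
    also have "(symb k * ?t)\<^sup>2 + 1 = (symb k ^ 3 * (norm (a k))\<^sup>2 + 1 / symb k) * symb k"
      using symb_pos[of k, THEN less_imp_neq] by (simp add: field_simps power2_eq_square power3_eq_cube)
    finally have "?t \<le> symb k ^ 3 * (norm (a k))\<^sup>2 + 1 / symb k"
      by (rule mult_right_le_imp_le) simp
    then show ?thesis by (simp add: norm_mult less_imp_le)
  qed
  show m: "(\<lambda>k. norm (symb k * a k)) summable_on UNIV"
    by (rule summable_on_comparison_test[OF summable_on_add[OF A summable_inverse_symb]])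
      (use le in auto)
  show "(\<lambda>k. norm (a k)) summable_on UNIV"
  proof (rule summable_on_comparison_test[OF m])
    show "norm (a k) \<le> norm (symb k * a k)" for k
      using mult_right_mono[OF symb_ge_1[of k], of "norm (a k)"] symb_pos[of k]
      by (simp add: norm_mult)
  qed auto
qed

text \<open>The double series converges absolutely: the coefficients of m are summable in k, those
  of u in k - j, and \<open>n\<close> is bounded. Hence its rows may be summed first, which brings
  in \<open>C\<close>, while finite squares of indices carry the estimate to the limit.\<close>

lemma energy_bound:
  fixes a n C :: "int \<Rightarrow> complex"
  assumes A: "(\<lambda>k. symb k ^ 3 * (norm (a k))\<^sup>2) summable_on UNIV"
    and g: "integrable circle g" and M: "AE x in circle. \<bar>g x\<bar> \<le> M" and M0: "0 \<le> M"
    and ga: "\<And>k. fourier_coeff g k = 2 * pi * \<i> * of_int k * a k"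
    and a: "\<And>k. a (- k) = cnj (a k)"
    and n: "\<And>k. n k = 2 * pi * \<i> * of_int k * (symb k * a k)"
    and C: "\<And>k. ((\<lambda>j. a (k - j) * n j) has_sum C k) UNIV"
    and h: "0 < h"
  shows "\<bar>\<Sum>\<^sub>\<infinity>k. Re ((norm (fexp k h - 1))\<^sup>2 * C k * cnj (symb k * a k))\<bar>
           \<le> 3 / 2 * M * h\<^sup>2 * (\<Sum>\<^sub>\<infinity>k. symb k ^ 3 * (norm (a k))\<^sup>2)"
proof -
  define Z where "Z = (\<Sum>\<^sub>\<infinity>k. symb k ^ 3 * (norm (a k))\<^sup>2)"
  define w where "w k = (norm (fexp k h - 1))\<^sup>2" for k
  define f where "f = (\<lambda>(k, j). w k * (a (k - j) * n j) * cnj (symb k * a k))"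
  have n_le: "(norm (n k))\<^sup>2 \<le> symb k ^ 3 * (norm (a k))\<^sup>2" for k
  proof -
    have "(norm (n k))\<^sup>2 = (2 * pi * of_int k)\<^sup>2 * (symb k ^ 2 * (norm (a k))\<^sup>2)"
      by (simp add: n norm_mult power_mult_distrib)
    also have "\<dots> \<le> symb k * (symb k ^ 2 * (norm (a k))\<^sup>2)"
      by (intro mult_right_mono) (auto simp: symb_def)
    finally show ?thesis by (simp add: power2_eq_square power3_eq_cube mult_ac)
  qed
  have sumZ: "(\<Sum>k\<in>F. (norm (n k))\<^sup>2) \<le> Z" if "finite F" for F
  proof -
    have "(\<Sum>k\<in>F. (norm (n k))\<^sup>2) \<le> (\<Sum>k\<in>F. symb k ^ 3 * (norm (a k))\<^sup>2)"
      by (intro sum_mono n_le)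
    also have "\<dots> \<le> Z"
      unfolding Z_def using A that by (intro finite_sum_le_infsum) (auto simp: less_imp_le)
    finally show ?thesis .
  qed
  \<comment> \<open>The coefficients of m_x are controlled only in square sum, and a uniform bound
    is what the comparison below uses.\<close>
  have nZ: "norm (n k) \<le> sqrt Z" for k
    using sumZ[of "{k}"] by (simp add: real_le_rsqrt)
  have w4: "w k \<le> 4" "0 \<le> w k" for k
  proof -
    have "norm (fexp k h - 1) \<le> 2"
      using norm_triangle_ineq4[of "fexp k h" 1] by simp
    then have "w k \<le> 2\<^sup>2" unfolding w_def by (rule power_mono) simp
    then show "w k \<le> 4" by simp
  qed (simp add: w_def)
  have "(\<lambda>(k, l). norm (symb k * a k) * norm (a l)) summable_on UNIV \<times> UNIV"
  proof (rule summable_on_SigmaI)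
    show "((\<lambda>l. case (k, l) of (k, l) \<Rightarrow> norm (symb k * a k) * norm (a l))
        has_sum norm (symb k * a k) * (\<Sum>\<^sub>\<infinity>l. norm (a l))) UNIV" for k
      using has_sum_cmult_right[OF has_sum_infsum[OF summable_symb_power(2)[OF A]]] by simp
    show "(\<lambda>k. norm (symb k * a k) * (\<Sum>\<^sub>\<infinity>l. norm (a l))) summable_on UNIV"
      using summable_symb_power(1)[OF A] by (rule summable_on_cmult_left)
  qed auto
  then have p: "(\<lambda>(k, j). norm (symb k * a k) * norm (a (k - j))) summable_on UNIV \<times> UNIV"
    by (subst summable_on_reindex_bij_witness[where i = "\<lambda>(k, l). (k, k - l)" and j = "\<lambda>(k, j). (k, k - j)"
          and h = "\<lambda>(k, l). norm (symb k * a k) * norm (a l)" and T = "UNIV \<times> UNIV"]) auto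
  have "(\<lambda>x. norm (f x)) summable_on UNIV \<times> UNIV"
  proof (rule summable_on_comparison_test)
    show "(\<lambda>x. 4 * sqrt Z * (case x of (k, j) \<Rightarrow> norm (symb k * a k) * norm (a (k - j)))) summable_on UNIV \<times> UNIV"
      using p by (rule summable_on_cmult_right)
    fix x :: "int \<times> int"
    obtain k j where x: "x = (k, j)" by fastforce
    have "norm (f x) = w k * norm (n j) * (norm (symb k * a k) * norm (a (k - j)))"
      using w4 by (simp add: f_def x norm_mult mult_ac)
    also have "\<dots> \<le> 4 * sqrt Z * (norm (symb k * a k) * norm (a (k - j)))"
      using w4 nZ by (intro mult_right_mono mult_mono) auto
    finally show "norm (f x) \<le> 4 * sqrt Z * (case x of (k, j) \<Rightarrow> norm (symb k * a k) * norm (a (k - j)))"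
      by (simp add: x)
  qed auto
  then have "f summable_on UNIV \<times> UNIV" by (rule abs_summable_summable)
  then obtain S where S: "(f has_sum S) (UNIV \<times> UNIV)" by (auto simp: summable_on_def)
  have "((\<lambda>j. f (k, j)) has_sum w k * C k * cnj (symb k * a k)) UNIV" for k
    using has_sum_cmult_left[OF has_sum_cmult_right[OF C[of k], of "w k"], of "cnj (symb k * a k)"]
    by (simp add: f_def)
  with S have "((\<lambda>k. w k * C k * cnj (symb k * a k)) has_sum S) UNIV"
    by (rule has_sum_SigmaD)
  then have "((\<lambda>k. Re (w k * C k * cnj (symb k * a k))) has_sum Re S) UNIV"
    by (rule has_sum_Re)
  then have lhs: "(\<Sum>\<^sub>\<infinity>k. Re (w k * C k * cnj (symb k * a k))) = Re S"
    by (rule infsumI)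
  have "\<bar>Re S\<bar> \<le> 3 / 2 * M * h\<^sup>2 * Z"
  proof (rule field_le_epsilon)
    fix e :: real assume "e > 0"
    have "\<forall>\<^sub>F X in finite_subsets_at_top (UNIV \<times> UNIV). dist (sum f X) S < e"
      using S \<open>e > 0\<close> unfolding has_sum_def by (rule tendstoD)
    then obtain X where X: "finite X" "\<And>Y. finite Y \<Longrightarrow> X \<subseteq> Y \<Longrightarrow> dist (sum f Y) S < e"
      unfolding eventually_finite_subsets_at_top by auto
    \<comment> \<open>The finite estimate concerns squares \<open>F \<times> F\<close>, so
      \<open>X\<close> is enlarged to one; the sum over any finite superset of \<open>X\<close> is
      still within e of \<open>S\<close>.\<close>
    define F where "F = fst ` X \<union> snd ` X"
    have F: "finite F" using X(1) by (simp add: F_def)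
    have XF: "X \<subseteq> F \<times> F" by (force simp: F_def)
    have "dist (sum f (F \<times> F)) S < e" using X(2)[OF _ XF] F by simp
    then have "\<bar>Re S - Re (sum f (F \<times> F))\<bar> < e"
      using abs_Re_le_cmod[of "S - sum f (F \<times> F)"] by (simp add: dist_norm norm_minus_commute)
    moreover have "sum f (F \<times> F) = (\<Sum>k\<in>F. \<Sum>j\<in>F. w k * (a (k - j) * n j) * cnj (symb k * a k))"
      by (simp add: f_def sum.cartesian_product)
    then have "\<bar>Re (sum f (F \<times> F))\<bar> \<le> 3 / 2 * M * h\<^sup>2 * (\<Sum>k\<in>F. (norm (n k))\<^sup>2)"
      using finite_energy_bound[OF g M M0 ga a n h F] by (simp add: w_def)
    moreover have "3 / 2 * M * h\<^sup>2 * (\<Sum>k\<in>F. (norm (n k))\<^sup>2) \<le> 3 / 2 * M * h\<^sup>2 * Z"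
      using sumZ[OF F] M0 by (intro mult_left_mono) auto
    ultimately show "\<bar>Re S\<bar> \<le> 3 / 2 * M * h\<^sup>2 * Z + e" by linarith
  qed
  then show ?thesis using lhs unfolding Z_def w_def by simp
qed

section \<open>Weighted square-summable sequences\<close>

text \<open>A divergent infinite sum has value 0, so a bound on \<open>wnorm2\<close> says something
  only together with \<open>wsum\<close>. The weight is a parameter in order to cover both the
  Sobolev weights and the weights of difference quotients, which vanish at k = 0.\<close>

definition wsum :: "(int \<Rightarrow> real) \<Rightarrow> (int \<Rightarrow> complex) \<Rightarrow> bool" where
  "wsum W x \<longleftrightarrow> (\<lambda>k. W k * (norm (x k))\<^sup>2) summable_on UNIV"

definition wnorm2 :: "(int \<Rightarrow> real) \<Rightarrow> (int \<Rightarrow> complex) \<Rightarrow> real" where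
  "wnorm2 W x = (\<Sum>\<^sub>\<infinity>k. W k * (norm (x k))\<^sup>2)"

definition winner :: "(int \<Rightarrow> real) \<Rightarrow> (int \<Rightarrow> complex) \<Rightarrow> (int \<Rightarrow> complex) \<Rightarrow> real" where
  "winner W x y = (\<Sum>\<^sub>\<infinity>k. W k * Re (x k * cnj (y k)))"

lemma wnorm2_nonneg: "(\<And>k. 0 \<le> W k) \<Longrightarrow> 0 \<le> wnorm2 W x"
  unfolding wnorm2_def by (intro infsum_nonneg) auto

lemma wsum_cmult: "wsum W x \<Longrightarrow> wsum W (\<lambda>k. c * x k)"
  unfolding wsum_def norm_mult power_mult_distrib
  using summable_on_cmult_right[of "\<lambda>k. W k * (norm (x k))\<^sup>2" UNIV "(norm c)\<^sup>2"] by (simp add: mult_ac)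

lemma wnorm2_cmult: "wnorm2 W (\<lambda>k. c * x k) = (norm c)\<^sup>2 * wnorm2 W x"
  unfolding wnorm2_def infsum_cmult_right'[symmetric]
  by (intro infsum_cong) (simp add: norm_mult power_mult_distrib)

lemma wsum_mono:
  assumes "wsum V x" "\<And>k. 0 \<le> W k" "\<And>k. W k \<le> K * V k"
  shows "wsum W x" and "wnorm2 W x \<le> K * wnorm2 V x"
proof -
  have s: "(\<lambda>k. K * (V k * (norm (x k))\<^sup>2)) summable_on UNIV"
    using assms(1) unfolding wsum_def by (rule summable_on_cmult_right)
  have le: "W k * (norm (x k))\<^sup>2 \<le> K * (V k * (norm (x k))\<^sup>2)" for k
    using mult_right_mono[OF assms(3)[of k], of "(norm (x k))\<^sup>2"] by (simp add: mult.assoc)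
  show W: "wsum W x" unfolding wsum_def
    by (rule summable_on_comparison_test[OF s]) (use le assms(2) in auto)
  show "wnorm2 W x \<le> K * wnorm2 V x"
    unfolding wnorm2_def infsum_cmult_right'[symmetric]
    by (rule infsum_mono) (use W s le in \<open>auto simp: wsum_def\<close>)
qed

lemma winner_summable:
  assumes W: "\<And>k. 0 \<le> W k" and x: "wsum W x" and y: "wsum W y"
  shows "(\<lambda>k. W k * Re (x k * cnj (y k))) summable_on UNIV"
proof -
  have "(\<lambda>k. norm (W k * Re (x k * cnj (y k)))) summable_on UNIV"
  proof (rule summable_on_comparison_test)
    show "(\<lambda>k. W k * (norm (x k))\<^sup>2 + W k * (norm (y k))\<^sup>2) summable_on UNIV"
      using x y unfolding wsum_def by (rule summable_on_add)
    fix k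
    have "\<bar>Re (x k * cnj (y k))\<bar> \<le> norm (x k) * norm (y k)"
      using abs_Re_le_cmod[of "x k * cnj (y k)"] by (simp add: norm_mult)
    also have "\<dots> \<le> (norm (x k))\<^sup>2 + (norm (y k))\<^sup>2"
      using sum_squares_bound[of "norm (x k)" "norm (y k)"] mult_nonneg_nonneg[OF norm_ge_zero norm_ge_zero, of "x k" "y k"]
      by linarith
    finally show "norm (W k * Re (x k * cnj (y k))) \<le> W k * (norm (x k))\<^sup>2 + W k * (norm (y k))\<^sup>2"
      using W[of k] by (simp add: abs_mult mult_left_mono distrib_left[symmetric])
  qed auto
  then show ?thesis by (rule abs_summable_summable)
qed

text \<open>Polarization, on which continuity and differentiability of \<open>wnorm2\<close> along a
  curve both rest.\<close>

lemma wnorm2_add: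
  assumes W: "\<And>k. 0 \<le> W k" and x: "wsum W x" and y: "wsum W y"
  shows "wsum W (\<lambda>k. x k + y k)"
    and "wnorm2 W (\<lambda>k. x k + y k) = wnorm2 W x + wnorm2 W y + 2 * winner W x y"
proof -
  have e: "W k * (norm (x k + y k))\<^sup>2
      = W k * (norm (x k))\<^sup>2 + W k * (norm (y k))\<^sup>2 + 2 * (W k * Re (x k * cnj (y k)))" for k
    unfolding cmod_power2 by (simp add: algebra_simps power2_eq_square)
  have "((\<lambda>k. W k * (norm (x k + y k))\<^sup>2) has_sum (wnorm2 W x + wnorm2 W y + 2 * winner W x y)) UNIV"
    unfolding e wnorm2_def winner_def
    using x y winner_summable[OF assms]
    by (intro has_sum_add has_sum_cmult_right has_sum_infsum) (auto simp: wsum_def)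
  then show "wsum W (\<lambda>k. x k + y k)"
    and "wnorm2 W (\<lambda>k. x k + y k) = wnorm2 W x + wnorm2 W y + 2 * winner W x y"
    by (auto simp: wsum_def wnorm2_def summable_on_def infsumI)
qed

lemma winner_add_left:
  assumes W: "\<And>k. 0 \<le> W k" and x: "wsum W x" and y: "wsum W y" and z: "wsum W z"
  shows "winner W (\<lambda>k. x k + y k) z = winner W x z + winner W y z"
  unfolding winner_def using winner_summable[OF W x z] winner_summable[OF W y z]
  by (subst infsum_add[symmetric]) (auto simp: algebra_simps)

lemma winner_cmult_left: "winner W (\<lambda>k. of_real c * x k) y = c * winner W x y"
  unfolding winner_def infsum_cmult_right'[symmetric]
  by (intro infsum_cong) (simp add: algebra_simps)

text \<open>Cauchy-Schwarz on finite sums for the vectors with entries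
  \<open>sqrt (W k) * norm (x k)\<close>, a form that tolerates vanishing weights.\<close>

lemma winner_bound:
  assumes W: "\<And>k. 0 \<le> W k" and x: "wsum W x" and y: "wsum W y"
  shows "\<bar>winner W x y\<bar> \<le> sqrt (wnorm2 W x) * sqrt (wnorm2 W y)"
proof -
  have le: "winner W x y \<le> sqrt (wnorm2 W x) * sqrt (wnorm2 W y)" if x: "wsum W x" for x
    unfolding winner_def
  proof (rule infsum_le_finite_sums[OF winner_summable[OF W x y]])
    fix F :: "int set" assume F: "finite F"
    have sq: "L2_set (\<lambda>k. sqrt (W k) * norm (z k)) F \<le> sqrt (wnorm2 W z)" if "wsum W z" for z
      unfolding L2_set_def wnorm2_def using that F W
      by (auto simp: power_mult_distrib wsum_def intro!: finite_sum_le_infsum)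
    have "(\<Sum>k\<in>F. W k * Re (x k * cnj (y k))) \<le> (\<Sum>k\<in>F. \<bar>sqrt (W k) * norm (x k)\<bar> * \<bar>sqrt (W k) * norm (y k)\<bar>)"
    proof (rule sum_mono)
      fix k
      have "Re (x k * cnj (y k)) \<le> norm (x k) * norm (y k)"
        using complex_Re_le_cmod[of "x k * cnj (y k)"] by (simp add: norm_mult)
      then have "W k * Re (x k * cnj (y k)) \<le> W k * (norm (x k) * norm (y k))"
        using W[of k] by (rule mult_left_mono)
      also have "\<dots> = (sqrt (W k) * sqrt (W k)) * (norm (x k) * norm (y k))"
        using W[of k] by simp
      also have "\<dots> = \<bar>sqrt (W k) * norm (x k)\<bar> * \<bar>sqrt (W k) * norm (y k)\<bar>"
        using W[of k] by (simp only: abs_mult abs_norm_cancel real_sqrt_abs real_sqrt_ge_zero abs_of_nonneg mult_ac)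
      finally show "W k * Re (x k * cnj (y k)) \<le> \<bar>sqrt (W k) * norm (x k)\<bar> * \<bar>sqrt (W k) * norm (y k)\<bar>" .
    qed
    also have "\<dots> \<le> L2_set (\<lambda>k. sqrt (W k) * norm (x k)) F * L2_set (\<lambda>k. sqrt (W k) * norm (y k)) F"
      by (rule L2_set_mult_ineq)
    also have "\<dots> \<le> sqrt (wnorm2 W x) * sqrt (wnorm2 W y)"
      by (intro mult_mono sq x y L2_set_nonneg real_sqrt_ge_zero wnorm2_nonneg W)
    finally show "(\<Sum>k\<in>F. W k * Re (x k * cnj (y k))) \<le> sqrt (wnorm2 W x) * sqrt (wnorm2 W y)" .
  qed
  \<comment> \<open>The lower bound is the upper bound for the negative of \<open>x\<close>.\<close>
  have "- winner W x y = winner W (\<lambda>k. of_real (- 1) * x k) y"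
    by (subst winner_cmult_left) simp
  also have "\<dots> \<le> sqrt (wnorm2 W x) * sqrt (wnorm2 W y)"
    using le[OF wsum_cmult[OF x, of "of_real (- 1)"]] wnorm2_cmult[of W "of_real (- 1)" x] by simp
  finally show ?thesis using le[OF x] by linarith
qed

lemma wnorm2_tendsto:
  assumes W: "\<And>k. 0 \<le> W k" and A: "\<And>r. r \<in> I \<Longrightarrow> wsum W (A r)" and t: "t \<in> I"
    and lim: "((\<lambda>r. wnorm2 W (\<lambda>k. A r k - A t k)) \<longlongrightarrow> 0) (at t within I)"
  shows "((\<lambda>r. wnorm2 W (A r)) \<longlongrightarrow> wnorm2 W (A t)) (at t within I)"
proof -
  let ?x = "\<lambda>r k. A r k - A t k"
  let ?N = "\<lambda>r. wnorm2 W (?x r)"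
  have bd: "\<bar>wnorm2 W (A r) - wnorm2 W (A t)\<bar> \<le> ?N r + 2 * (sqrt (?N r) * sqrt (wnorm2 W (A t)))" if "r \<in> I" for r
  proof -
    have x: "wsum W (?x r)"
      using wnorm2_add(1)[OF W A[OF that] wsum_cmult[OF A[OF t], of "- 1"]] by simp
    have "wnorm2 W (A r) = ?N r + wnorm2 W (A t) + 2 * winner W (?x r) (A t)"
      using wnorm2_add(2)[OF W x A[OF t]] by simp
    then show ?thesis
      using winner_bound[OF W x A[OF t]] wnorm2_nonneg[of W "?x r"] W by simp
  qed
  have "((\<lambda>r. ?N r + 2 * (sqrt (?N r) * sqrt (wnorm2 W (A t)))) \<longlongrightarrow> 0 + 2 * (sqrt 0 * sqrt (wnorm2 W (A t)))) (at t within I)"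
    by (intro tendsto_intros lim)
  then have lim0: "((\<lambda>r. ?N r + 2 * (sqrt (?N r) * sqrt (wnorm2 W (A t)))) \<longlongrightarrow> 0) (at t within I)"
    by simp
  have "((\<lambda>r. wnorm2 W (A r) - wnorm2 W (A t)) \<longlongrightarrow> 0) (at t within I)"
    by (rule Lim_null_comparison[OF _ lim0]) (use bd in \<open>auto simp: eventually_at_filter\<close>)
  then show ?thesis by (simp add: LIM_zero_iff)
qed

text \<open>If \<open>y r\<close> is the error of the difference quotient, then A r = A t + (r - t)
  (B + y r). Expanding the square leaves twice the pairing of \<open>B\<close> with
  \<open>A t\<close>, plus terms that vanish with \<open>y r\<close> or with r - t.\<close>

lemma wnorm2_has_derivative:
  assumes W: "\<And>k. 0 \<le> W k" and A: "\<And>r. r \<in> I \<Longrightarrow> wsum W (A r)" and B: "wsum W B" and t: "t \<in> I"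
    and lim: "((\<lambda>r. wnorm2 W (\<lambda>k. (A r k - A t k) / of_real (r - t) - B k)) \<longlongrightarrow> 0) (at t within I)"
  shows "((\<lambda>r. wnorm2 W (A r)) has_real_derivative 2 * winner W B (A t)) (at t within I)"
proof -
  define y where "y r k = (A r k - A t k) / of_real (r - t) - B k" for r k
  let ?N = "\<lambda>r. wnorm2 W (y r)"
  let ?e = "\<lambda>r. 2 * (sqrt (?N r) * sqrt (wnorm2 W (A t)))
      + \<bar>r - t\<bar> * (wnorm2 W B + ?N r + 2 * (sqrt (wnorm2 W B) * sqrt (?N r)))"
  have bd: "\<bar>(wnorm2 W (A r) - wnorm2 W (A t)) / (r - t) - 2 * winner W B (A t)\<bar> \<le> ?e r"
    if r: "r \<in> I" "r \<noteq> t" for r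
  proof -
    have y: "wsum W (y r)"
      using wnorm2_add(1)[OF W wsum_cmult[OF wnorm2_add(1)[OF W A[OF r(1)] wsum_cmult[OF A[OF t], of "- 1"]], of "1 / of_real (r - t)"]
          wsum_cmult[OF B, of "- 1"]]
      by (simp add: y_def[abs_def])
    define x where "x k = B k + y r k" for k
    have x: "wsum W x" unfolding x_def by (rule wnorm2_add(1)[OF W B y])
    have Ar: "A r k = of_real (r - t) * x k + A t k" for k
      using r by (simp add: x_def y_def)
    have "wnorm2 W (A r) = (r - t)\<^sup>2 * wnorm2 W x + wnorm2 W (A t) + 2 * ((r - t) * winner W x (A t))"
      using wnorm2_add(2)[OF W wsum_cmult[OF x, of "of_real (r - t)"] A[OF t]]
      unfolding Ar[symmetric] wnorm2_cmult winner_cmult_left norm_of_real power2_abs .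
    moreover have "winner W x (A t) = winner W B (A t) + winner W (y r) (A t)"
      unfolding x_def by (rule winner_add_left[OF W B y A[OF t]])
    ultimately have "(wnorm2 W (A r) - wnorm2 W (A t)) / (r - t) - 2 * winner W B (A t)
        = 2 * winner W (y r) (A t) + (r - t) * wnorm2 W x"
      using r by (simp add: field_simps power2_eq_square)
    also have "\<bar>\<dots>\<bar> \<le> 2 * (sqrt (?N r) * sqrt (wnorm2 W (A t))) + \<bar>r - t\<bar> * wnorm2 W x"
      using winner_bound[OF W y A[OF t]] wnorm2_nonneg[of W x] W
      by (intro order_trans[OF abs_triangle_ineq] add_mono) (auto simp: abs_mult)
    also have "\<dots> \<le> ?e r"
    proof (intro add_mono mult_left_mono)
      show "wnorm2 W x \<le> wnorm2 W B + ?N r + 2 * (sqrt (wnorm2 W B) * sqrt (?N r))"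
        using winner_bound[OF W B y] wnorm2_add(2)[OF W B y] unfolding x_def by linarith
    qed (auto simp: wnorm2_nonneg W)
    finally show ?thesis .
  qed
  have "(?e \<longlongrightarrow> 2 * (sqrt 0 * sqrt (wnorm2 W (A t)))
      + \<bar>t - t\<bar> * (wnorm2 W B + 0 + 2 * (sqrt (wnorm2 W B) * sqrt 0))) (at t within I)"
    unfolding y_def by (intro tendsto_intros lim)
  then have lim0: "(?e \<longlongrightarrow> 0) (at t within I)" by simp
  have "((\<lambda>r. (wnorm2 W (A r) - wnorm2 W (A t)) / (r - t) - 2 * winner W B (A t)) \<longlongrightarrow> 0) (at t within I)"
    by (rule Lim_null_comparison[OF _ lim0]) (use bd in \<open>auto simp: eventually_at_filter\<close>)
  then show ?thesis by (simp add: has_field_derivative_iff LIM_zero_iff)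
qed

section \<open>Evolution of the Sobolev norm\<close>

lemma sobolev_integrable:
  assumes "f \<in> sobolev s"
  shows "integrable circle f"
proof (rule Bochner_Integration.integrable_bound)
  interpret finite_measure circle by (rule finite_measure_circle)
  show "integrable circle (\<lambda>x. 1 + (f x)\<^sup>2)" using assms by (auto simp: sobolev_def)
  show "f \<in> borel_measurable circle" using assms by (simp add: sobolev_def)
  have "\<bar>y\<bar> \<le> 1 + y\<^sup>2" for y :: real
    using sum_squares_bound[of 1 "\<bar>y\<bar>"] abs_ge_zero[of y] by (simp del: abs_ge_zero)
  then show "AE x in circle. norm (f x) \<le> norm (1 + (f x)\<^sup>2)"
    by (auto simp: abs_of_nonneg add_nonneg_nonneg)
qed

lemma fourier_coeff_diff:
  assumes "integrable circle f" "integrable circle g"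
  shows "fourier_coeff (\<lambda>x. f x - g x) k = fourier_coeff f k - fourier_coeff g k"
proof -
  have "integrable circle (\<lambda>x. complex_of_real (f x) * fexp (- k) x)"
    "integrable circle (\<lambda>x. complex_of_real (g x) * fexp (- k) x)"
    using assms by (auto intro!: integrable_circle_mult_fexp)
  then show ?thesis by (simp add: fourier_coeff_fexp left_diff_distrib)
qed

lemma fourier_coeff_cmult: "fourier_coeff (\<lambda>x. c * f x) k = of_real c * fourier_coeff f k"
  by (simp add: fourier_coeff_fexp mult.assoc)

lemma sobolev_wsum: "f \<in> sobolev s \<Longrightarrow> wsum (\<lambda>k. symb k powr s) (fourier_coeff f)"
  by (simp add: sobolev_def wsum_def symb_def)

lemma sobolev_norm_wnorm2: "sobolev_norm s f = sqrt (wnorm2 (\<lambda>k. symb k powr s) (fourier_coeff f))"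
  by (simp add: sobolev_norm_def wnorm2_def symb_def)

lemma C0_sobolev_fourier:
  assumes u: "C0_sobolev T s u" and t: "t \<in> time_interval T"
  shows "integrable circle (u t)"
    and "wsum (\<lambda>k. symb k powr s) (fourier_coeff (u t))"
    and "((\<lambda>r. wnorm2 (\<lambda>k. symb k powr s) (\<lambda>k. fourier_coeff (u r) k - fourier_coeff (u t) k)) \<longlongrightarrow> 0)
           (at t within time_interval T)"
proof -
  have i: "integrable circle (u r)" if "r \<in> time_interval T" for r
    using u that by (auto simp: C0_sobolev_def intro: sobolev_integrable)
  then show "integrable circle (u t)" using t by blast
  show "wsum (\<lambda>k. symb k powr s) (fourier_coeff (u t))"
    using u t by (auto simp: C0_sobolev_def intro: sobolev_wsum)
  have fc: "fourier_coeff (\<lambda>x. u r x - u t x) = (\<lambda>k. fourier_coeff (u r) k - fourier_coeff (u t) k)"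
    if "r \<in> time_interval T" for r
    using fourier_coeff_diff[OF i[OF that] i[OF t]] by (rule ext)
  \<comment> \<open>Squaring removes the root in \<open>sobolev_norm\<close>, which leaves
    \<open>wnorm2\<close>.\<close>
  have "((\<lambda>r. (sobolev_norm s (\<lambda>x. u r x - u t x))\<^sup>2) \<longlongrightarrow> 0\<^sup>2) (at t within time_interval T)"
    using u t by (intro tendsto_power) (auto simp: C0_sobolev_def)
  moreover have "\<forall>\<^sub>F r in at t within time_interval T. (sobolev_norm s (\<lambda>x. u r x - u t x))\<^sup>2
      = wnorm2 (\<lambda>k. symb k powr s) (\<lambda>k. fourier_coeff (u r) k - fourier_coeff (u t) k)"
    by (auto simp: eventually_at_filter sobolev_norm_wnorm2 wnorm2_nonneg fc)
  ultimately show "((\<lambda>r. wnorm2 (\<lambda>k. symb k powr s) (\<lambda>k. fourier_coeff (u r) k - fourier_coeff (u t) k)) \<longlongrightarrow> 0)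
           (at t within time_interval T)"
    by (simp add: tendsto_cong)
qed

lemma C1_sobolev_fourier:
  assumes u: "C1_sobolev T s u v" and t: "t \<in> time_interval T"
  shows "((\<lambda>r. wnorm2 (\<lambda>k. symb k powr s)
             (\<lambda>k. (fourier_coeff (u r) k - fourier_coeff (u t) k) / of_real (r - t) - fourier_coeff (v t) k)) \<longlongrightarrow> 0)
           (at t within time_interval T)"
proof -
  have iu: "integrable circle (u r)" and iv: "integrable circle (v r)" if "r \<in> time_interval T" for r
    using u that by (auto simp: C1_sobolev_def intro: C0_sobolev_fourier)
  have fc: "fourier_coeff (\<lambda>x. (u r x - u t x) / (r - t) - v t x)
      = (\<lambda>k. (fourier_coeff (u r) k - fourier_coeff (u t) k) / of_real (r - t) - fourier_coeff (v t) k)"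
    if r: "r \<in> time_interval T" for r
  proof
    fix k
    have "integrable circle (\<lambda>x. (1 / (r - t)) * (u r x - u t x))"
      using iu[OF r] iu[OF t] by (intro integrable_mult_right Bochner_Integration.integrable_diff)
    from fourier_coeff_diff[OF this iv[OF t]]
    show "fourier_coeff (\<lambda>x. (u r x - u t x) / (r - t) - v t x) k
      = (fourier_coeff (u r) k - fourier_coeff (u t) k) / of_real (r - t) - fourier_coeff (v t) k"
      by (simp only: fourier_coeff_cmult fourier_coeff_diff[OF iu[OF r] iu[OF t]]) (simp add: divide_inverse mult.commute)
  qed
  have "((\<lambda>r. (sobolev_norm s (\<lambda>x. (u r x - u t x) / (r - t) - v t x))\<^sup>2) \<longlongrightarrow> 0\<^sup>2) (at t within time_interval T)"
    using u t by (intro tendsto_power) (auto simp: C1_sobolev_def)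
  moreover have "\<forall>\<^sub>F r in at t within time_interval T. (sobolev_norm s (\<lambda>x. (u r x - u t x) / (r - t) - v t x))\<^sup>2
      = wnorm2 (\<lambda>k. symb k powr s)
          (\<lambda>k. (fourier_coeff (u r) k - fourier_coeff (u t) k) / of_real (r - t) - fourier_coeff (v t) k)"
    by (auto simp: eventually_at_filter sobolev_norm_wnorm2 wnorm2_nonneg fc simp del: of_real_diff)
  ultimately show ?thesis by (simp add: tendsto_cong)
qed

lemma AE_circle: "AE x in lebesgue. P x \<Longrightarrow> AE x in circle. P x"
  by (subst AE_restrict_space_iff) (auto elim: eventually_mono)

text \<open>The transport equation at one time, frequency by frequency. \<open>C\<close> holds the
  coefficients of u m_x, so that the later estimates see \<open>u\<close> and \<open>ut\<close>
  through their coefficients only.\<close>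

lemma equation_fourier:
  fixes c :: real and u ut ux utxx uxxx :: "real \<Rightarrow> real"
  assumes u: "u \<in> sobolev 3"
    and utxx: "weak_deriv 2 ut utxx" and ux: "weak_deriv 1 u ux" and uxxx: "weak_deriv 3 u uxxx"
    and eq: "AE x in lebesgue. ut x - utxx x + c * u x * ux x = c * u x * uxxx x"
  obtains C where
    "\<And>k. ((\<lambda>j. fourier_coeff u (k - j) * (2 * pi * \<i> * of_int j * (symb j * fourier_coeff u j))) has_sum C k) UNIV"
    "\<And>k. symb k * fourier_coeff ut k = - of_real c * C k"
proof -
  \<comment> \<open>This is m_x, written with the weak derivatives at hand so that none of m has to
    be constructed.\<close>
  define n where "n x = ux x - uxxx x" for x
  have int: "integrable circle u" "integrable circle ut" "integrable circle utxx" "integrable circle ux" "integrable circle uxxx"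
    using utxx ux uxxx by (auto simp: weak_deriv_def)
  have n: "integrable circle n"
    unfolding n_def using int by simp
  have fn: "fourier_coeff n j = 2 * pi * \<i> * of_int j * (symb j * fourier_coeff u j)" for j
    unfolding n_def fourier_coeff_diff[OF int(4,5)] fourier_coeff_weak_deriv[OF ux] fourier_coeff_weak_deriv[OF uxxx]
    by (simp add: symb_def power2_eq_square power3_eq_cube algebra_simps)
  have s: "(\<lambda>k. norm (fourier_coeff u k)) summable_on UNIV"
    using sobolev_wsum[OF u] by (intro summable_symb_power(2)) (simp add: wsum_def)
  note conv = has_sum_fourier_coeff_mult[OF int(1) s n]
  show thesis
  proof (rule that[of "fourier_coeff (\<lambda>x. u x * n x)"])
    show "((\<lambda>j. fourier_coeff u (k - j) * (2 * pi * \<i> * of_int j * (symb j * fourier_coeff u j))) has_sum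
        fourier_coeff (\<lambda>x. u x * n x) k) UNIV" for k
      using conv(2)[of k] by (simp only: fn)
    show "symb k * fourier_coeff ut k = - of_real c * fourier_coeff (\<lambda>x. u x * n x) k" for k
    proof -
      have "symb k * fourier_coeff ut k = fourier_coeff (\<lambda>x. ut x - utxx x) k"
        unfolding fourier_coeff_diff[OF int(2,3)] fourier_coeff_weak_deriv[OF utxx]
        by (simp add: symb_def power2_eq_square algebra_simps)
      also have "\<dots> = fourier_coeff (\<lambda>x. - c * (u x * n x)) k"
        unfolding fourier_coeff_fexp
      proof (rule integral_cong_AE)
        show "(\<lambda>x. complex_of_real (ut x - utxx x) * fexp (- k) x) \<in> borel_measurable circle"
          using int by measurable
        show "(\<lambda>x. complex_of_real (- c * (u x * n x)) * fexp (- k) x) \<in> borel_measurable circle"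
          using conv(1) by measurable
        show "AE x in circle. complex_of_real (ut x - utxx x) * fexp (- k) x
            = complex_of_real (- c * (u x * n x)) * fexp (- k) x"
          using AE_circle[OF eq]
        proof eventually_elim
          case (elim x)
          then have "ut x - utxx x = - c * (u x * n x)" by (simp add: n_def algebra_simps)
          then show ?case by (simp only:)
        qed
      qed
      finally show ?thesis by (simp only: fourier_coeff_cmult of_real_minus)
    qed
  qed
qed

text \<open>\<open>wnorm2 (diff_weight h) a\<close> is the squared \<open>L\<^sup>2\<close> norm of the difference quotient of \<open>m\<close> with step \<open>h\<close>.\<close>

definition diff_weight :: "real \<Rightarrow> int \<Rightarrow> real" where
  "diff_weight h k = (norm (fexp k h - 1))\<^sup>2 / h\<^sup>2 * symb k ^ 2"

lemma diff_weight_nonneg: "0 \<le> diff_weight h k"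
  by (simp add: diff_weight_def)

text \<open>Two comparisons with opposite virtues. The first is uniform in h but calls for the H^3
  norm. The second degenerates as h tends to 0 but calls only for the H^2 norm, in which u is
  differentiable in time.\<close>

lemma diff_weight_le:
  assumes "h > 0"
  shows "diff_weight h k \<le> symb k ^ 3" and "diff_weight h k \<le> 4 / h\<^sup>2 * symb k ^ 2"
proof -
  have "(norm (fexp k h - 1))\<^sup>2 \<le> \<bar>2 * pi * of_int k * h\<bar>\<^sup>2"
    by (intro power_mono norm_fexp_minus_1_le) simp
  also have "\<dots> = (2 * pi * of_int k)\<^sup>2 * h\<^sup>2" by (simp only: power2_abs power_mult_distrib)
  finally have "(norm (fexp k h - 1))\<^sup>2 / h\<^sup>2 \<le> (2 * pi * of_int k)\<^sup>2"
    using assms by (simp add: divide_le_eq)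
  also have "\<dots> \<le> symb k" by (simp add: symb_def)
  finally have "diff_weight h k \<le> symb k * symb k ^ 2"
    unfolding diff_weight_def by (rule mult_right_mono) simp
  then show "diff_weight h k \<le> symb k ^ 3" by (simp add: power2_eq_square power3_eq_cube)
  have "norm (fexp k h - 1) \<le> 2" using norm_triangle_ineq4[of "fexp k h" 1] by simp
  then have "(norm (fexp k h - 1))\<^sup>2 \<le> 2\<^sup>2" by (rule power_mono) simp
  then show "diff_weight h k \<le> 4 / h\<^sup>2 * symb k ^ 2"
    unfolding diff_weight_def by (intro mult_right_mono divide_right_mono) simp_all
qed

text \<open>The factor before \<open>symb k ^ 2\<close> is the squared modulus of a difference
  quotient of the exponential at 0. The limit is the weight of the squared L^2 norm of m_x.\<close>

lemma diff_weight_tendsto: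
  "((\<lambda>h. diff_weight h k) \<longlongrightarrow> (2 * pi * of_int k)\<^sup>2 * symb k ^ 2) (at_right 0)"
proof -
  let ?w = "2 * pi * \<i> * of_int k"
  have "((\<lambda>z. exp (?w * z)) has_field_derivative ?w) (at 0)"
    by (auto intro!: derivative_eq_intros)
  then have "((\<lambda>z. (exp (?w * z) - 1) / z) \<longlongrightarrow> ?w) (at 0)"
    by (simp add: has_field_derivative_iff)
  moreover have "filterlim complex_of_real (at 0) (at_right 0)"
    by (rule filterlim_atI) (auto intro!: tendsto_eq_intros simp: eventually_at_filter)
  ultimately have "((\<lambda>h. (exp (?w * complex_of_real h) - 1) / complex_of_real h) \<longlongrightarrow> ?w) (at_right 0)"
    by (rule filterlim_compose)
  then have "((\<lambda>h. (norm ((exp (?w * complex_of_real h) - 1) / complex_of_real h))\<^sup>2 * symb k ^ 2)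
      \<longlongrightarrow> (norm ?w)\<^sup>2 * symb k ^ 2) (at_right 0)"
    by (intro tendsto_intros)
  moreover have "exp (?w * complex_of_real h) = fexp k h" for h
    by (simp add: fexp_def cis_conv_exp mult_ac)
  ultimately show ?thesis
    by (simp add: diff_weight_def[abs_def] norm_divide norm_mult power_divide power_mult_distrib)
qed

text \<open>A Fatou argument: over finitely many frequencies the limit h -> 0 passes under the sum,
  and a bound on all finite sums bounds the series.\<close>

lemma wnorm2_symb_le:
  assumes a: "wsum (\<lambda>k. symb k ^ 3) a" and R: "\<And>h. h > 0 \<Longrightarrow> wnorm2 (diff_weight h) a \<le> R"
  shows "wnorm2 (\<lambda>k. symb k ^ 3) a \<le> (norm (a 0))\<^sup>2 + 2 * R"
  unfolding wnorm2_def
proof (rule infsum_le_finite_sums)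
  show "(\<lambda>k. symb k ^ 3 * (norm (a k))\<^sup>2) summable_on UNIV" using a by (simp add: wsum_def)
  fix F :: "int set" assume F: "finite F"
  have "((\<lambda>h. \<Sum>k\<in>F. diff_weight h k * (norm (a k))\<^sup>2) \<longlongrightarrow>
      (\<Sum>k\<in>F. (2 * pi * of_int k)\<^sup>2 * symb k ^ 2 * (norm (a k))\<^sup>2)) (at_right 0)"
    by (intro tendsto_intros diff_weight_tendsto)
  moreover have "\<forall>\<^sub>F h in at_right 0. (\<Sum>k\<in>F. diff_weight h k * (norm (a k))\<^sup>2) \<le> R"
    using eventually_at_right_less[of 0]
  proof eventually_elim
    case (elim h)
    have "wsum (diff_weight h) a"
      using wsum_mono(1)[where W = "diff_weight h" and K = 1, OF a diff_weight_nonneg] diff_weight_le(1)[OF elim] by simp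
    then have "(\<Sum>k\<in>F. diff_weight h k * (norm (a k))\<^sup>2) \<le> wnorm2 (diff_weight h) a"
      unfolding wnorm2_def wsum_def using F diff_weight_nonneg by (intro finite_sum_le_infsum) auto
    then show ?case using R[OF elim] by linarith
  qed
  ultimately have le: "(\<Sum>k\<in>F. (2 * pi * of_int k)\<^sup>2 * symb k ^ 2 * (norm (a k))\<^sup>2) \<le> R"
    by (rule tendsto_upperbound) simp
  \<comment> \<open>The limit weight misses k = 0, where \<open>symb\<close> is 1. Elsewhere (2 pi
    k)^2 is at least 1, so \<open>symb k\<close> is at most twice that square; hence the factor
    2.\<close>
  have "symb k ^ 3 * (norm (a k))\<^sup>2 \<le> (if k = 0 then (norm (a 0))\<^sup>2 else 0)
      + 2 * ((2 * pi * of_int k)\<^sup>2 * symb k ^ 2 * (norm (a k))\<^sup>2)" for k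
  proof (cases "k = 0")
    case False
    have "1\<^sup>2 \<le> \<bar>2 * pi * of_int k\<bar>\<^sup>2"
    proof (rule power_mono)
      have "1 * 1 \<le> (2 * pi) * \<bar>real_of_int k\<bar>"
        using pi_gt3 False by (intro mult_mono) auto
      then show "1 \<le> \<bar>2 * pi * of_int k\<bar>" by (simp add: abs_mult)
    qed simp
    then have "symb k \<le> 2 * (2 * pi * of_int k)\<^sup>2" unfolding symb_def power2_abs by simp
    then have "symb k * (symb k ^ 2 * (norm (a k))\<^sup>2) \<le> 2 * (2 * pi * of_int k)\<^sup>2 * (symb k ^ 2 * (norm (a k))\<^sup>2)"
      by (rule mult_right_mono) simp
    then show ?thesis using False by (simp add: power2_eq_square power3_eq_cube mult_ac)
  qed (simp add: symb_def)
  then have "(\<Sum>k\<in>F. symb k ^ 3 * (norm (a k))\<^sup>2) \<le> (\<Sum>k\<in>F. (if k = 0 then (norm (a 0))\<^sup>2 else 0)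
      + 2 * ((2 * pi * of_int k)\<^sup>2 * symb k ^ 2 * (norm (a k))\<^sup>2))"
    by (rule sum_mono)
  also have "\<dots> = (\<Sum>k\<in>F. if k = 0 then (norm (a 0))\<^sup>2 else 0)
      + 2 * (\<Sum>k\<in>F. (2 * pi * of_int k)\<^sup>2 * symb k ^ 2 * (norm (a k))\<^sup>2)"
    by (simp add: sum.distrib sum_distrib_left)
  also have "\<dots> \<le> (norm (a 0))\<^sup>2 + 2 * R"
    using le F by (intro add_mono) auto
  finally show "(\<Sum>k\<in>F. symb k ^ 3 * (norm (a k))\<^sup>2) \<le> (norm (a 0))\<^sup>2 + 2 * R" .
qed

text \<open>The equation supplies the factor -c, the 1 / h^2 of the weight cancels the h^2 of
  \<open>energy_bound\<close>, and twice 3 / 2 makes 3. The rate is thus independent of h.\<close>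

lemma energy_rate_bound:
  fixes a b C :: "int \<Rightarrow> complex"
  assumes A: "wsum (\<lambda>k. symb k ^ 3) a"
    and g: "integrable circle g" and M: "AE x in circle. \<bar>g x\<bar> \<le> M" and M0: "0 \<le> M"
    and ga: "\<And>k. fourier_coeff g k = 2 * pi * \<i> * of_int k * a k"
    and a: "\<And>k. a (- k) = cnj (a k)"
    and C: "\<And>k. ((\<lambda>j. a (k - j) * (2 * pi * \<i> * of_int j * (symb j * a j))) has_sum C k) UNIV"
    and b: "\<And>k. symb k * b k = - of_real c * C k"
    and h: "0 < h" and c: "0 < c"
  shows "2 * winner (diff_weight h) b a \<le> 3 * c * M * wnorm2 (\<lambda>k. symb k ^ 3) a"
proof -
  let ?S = "\<Sum>\<^sub>\<infinity>k. Re ((norm (fexp k h - 1))\<^sup>2 * C k * cnj (symb k * a k))"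
  have "diff_weight h k * Re (b k * cnj (a k))
      = - c / h\<^sup>2 * Re ((norm (fexp k h - 1))\<^sup>2 * C k * cnj (symb k * a k))" for k
  proof -
    have "complex_of_real (diff_weight h k) * (b k * cnj (a k))
        = of_real ((norm (fexp k h - 1))\<^sup>2 / h\<^sup>2) * ((symb k * b k) * cnj (symb k * a k))"
      by (simp add: diff_weight_def power2_eq_square)
    also have "\<dots> = of_real (- c / h\<^sup>2) * ((norm (fexp k h - 1))\<^sup>2 * C k * cnj (symb k * a k))"
      unfolding b by (simp add: mult_ac)
    finally have "Re (complex_of_real (diff_weight h k) * (b k * cnj (a k)))
        = Re (of_real (- c / h\<^sup>2) * ((norm (fexp k h - 1))\<^sup>2 * C k * cnj (symb k * a k)))"
      by (rule arg_cong)
    moreover have "Re (complex_of_real x * z) = x * Re z" for x z by simp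
    ultimately show ?thesis by (simp only:)
  qed
  then have "winner (diff_weight h) b a = - c / h\<^sup>2 * ?S"
    unfolding winner_def infsum_cmult_right'[symmetric] by simp
  also have "\<dots> \<le> c / h\<^sup>2 * \<bar>?S\<bar>"
    using mult_left_mono[of "- ?S" "\<bar>?S\<bar>" "c / h\<^sup>2"] c by simp
  also have "\<dots> \<le> c / h\<^sup>2 * (3 / 2 * M * h\<^sup>2 * wnorm2 (\<lambda>k. symb k ^ 3) a)"
    unfolding wnorm2_def using energy_bound[OF _ g M M0 ga a refl C h] A c
    by (intro mult_left_mono) (auto simp: wsum_def)
  also have "\<dots> = 3 / 2 * c * M * wnorm2 (\<lambda>k. symb k ^ 3) a" using h by simp
  finally show ?thesis by simp
qed

section \<open>Supremum bounds and Gronwall's inequality\<close>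

lemma Linf_norm_nonneg: "0 \<le> Linf_norm f"
proof -
  \<comment> \<open>Over a null space the essential supremum of a measurable function would be minus
    infinity.\<close>
  have e: "emeasure circle (space circle) \<noteq> 0"
    by (simp add: emeasure_restrict_space space_restrict_space)
  have "esssup circle (\<lambda>x. 0) \<le> esssup circle (\<lambda>x. ereal \<bar>f x\<bar>)"
    by (rule esssup_mono) auto
  then show ?thesis using esssup_const[OF e, of "0 :: ereal"] by (simp add: Linf_norm_def)
qed

lemma AE_le_Linf_norm:
  assumes "Linf_norm f \<le> ereal M"
  shows "AE x in circle. \<bar>f x\<bar> \<le> M"
  using esssup_AE[of "\<lambda>x. ereal \<bar>f x\<bar>" circle]
proof eventually_elim
  case (elim x)
  then have "ereal \<bar>f x\<bar> \<le> ereal M" using assms unfolding Linf_norm_def by (rule order_trans)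
  then show ?case by simp
qed

lemma norm_fourier_coeff_le:
  assumes f: "integrable circle f" and M: "AE x in circle. \<bar>f x\<bar> \<le> M"
  shows "norm (fourier_coeff f k) \<le> M"
proof -
  have "norm (fourier_coeff f k) \<le> (LINT x|circle. \<bar>f x\<bar>)"
    unfolding fourier_coeff_fexp using integral_norm_bound[of circle "\<lambda>x. complex_of_real (f x) * fexp (- k) x"]
    by (simp add: norm_mult)
  also have "\<dots> \<le> (LINT x|circle. M)"
    using f M finite_measure.integrable_const[OF finite_measure_circle] by (intro integral_mono_AE) auto
  also have "\<dots> = M"
    by (simp add: measure_restrict_space space_restrict_space)
  finally show ?thesis .
qed

text \<open>\<open>Z\<close> is merely continuous, so the integrating factor is applied to the
  differentiable right-hand side \<open>A + K * I s\<close>, which dominates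
  \<open>Z\<close>.\<close>

lemma gronwall:
  fixes Z :: "real \<Rightarrow> real"
  assumes Z: "continuous_on {0..t} Z" and t: "0 \<le> t" and K: "0 \<le> K"
    and le: "\<And>s. s \<in> {0..t} \<Longrightarrow> Z s \<le> A + K * integral {0..s} Z"
  shows "Z t \<le> A * exp (K * t)"
proof -
  define I where "I s = integral {0..s} Z" for s
  have dI: "(I has_real_derivative Z s) (at s within {0..t})" if "s \<in> {0..t}" for s
    unfolding I_def by (rule integral_has_real_derivative[OF Z that])
  define Y where "Y s = (A + K * I s) * exp (- K * s)" for s
  have "Y t \<le> Y 0"
  proof (rule DERIV_nonpos_imp_decreasing_open[where f = Y and a = 0 and b = t])
    show "0 \<le> t" by (rule t)
    show "continuous_on {0..t} Y"
      unfolding Y_def by (intro continuous_intros DERIV_continuous_on[where D = Z] dI)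
    fix s :: real assume s: "0 < s" "s < t"
    then have "at s within {0..t} = at s" by (intro at_within_interior) auto
    then have "(I has_real_derivative Z s) (at s)" using dI[of s] s by simp
    then have "(Y has_real_derivative (K * (Z s - (A + K * I s))) * exp (- K * s)) (at s)"
      unfolding Y_def by (auto intro!: derivative_eq_intros simp: algebra_simps)
    moreover have "K * (Z s - (A + K * I s)) * exp (- K * s) \<le> 0"
      using le[of s] s K by (intro mult_nonpos_nonneg mult_nonneg_nonpos) (auto simp: I_def)
    ultimately show "\<exists>y. (Y has_real_derivative y) (at s) \<and> y \<le> 0" by blast
  qed
  then have "(A + K * I t) * exp (- K * t) \<le> A" by (simp add: Y_def I_def)
  then have "A + K * I t \<le> A * exp (K * t)"
    by (simp add: exp_minus divide_le_eq flip: divide_inverse)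
  then show ?thesis using le[of t] t by (simp add: I_def)
qed

section \<open>Integration in time and conclusion\<close>

lemma energy_integral_bound:
  fixes c :: real
  assumes c: "0 < c" and h: "0 < h" and u3: "C0_sobolev T 3 u" and u2: "C1_sobolev T 2 u ut"
    and eq: "\<And>t. t \<in> time_interval T \<Longrightarrow> t > 0 \<Longrightarrow>
         (\<exists>utxx ux uxxx.
            weak_deriv 2 (ut t) utxx \<and> weak_deriv 1 (u t) ux \<and> weak_deriv 3 (u t) uxxx \<and>
            (AE x in lebesgue. ut t x - utxx x + c * u t x * ux x = c * u t x * uxxx x))"
    and M0: "0 \<le> M"
    and M: "\<And>t. t \<in> time_interval T \<Longrightarrow> \<exists>ux. weak_deriv 1 (u t) ux \<and> (AE x in circle. \<bar>ux x\<bar> \<le> M)"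
    and t: "t \<in> time_interval T" and Z: "Z = (\<lambda>s. wnorm2 (\<lambda>k. symb k ^ 3) (fourier_coeff (u s)))"
    and cZ: "continuous_on {0..t} Z"
  shows "wnorm2 (diff_weight h) (fourier_coeff (u t)) \<le> Z 0 + 3 * c * M * integral {0..t} Z"
proof -
  let ?I = "time_interval T"
  define a where "a s = fourier_coeff (u s)" for s
  define E where "E s = wnorm2 (diff_weight h) (a s)" for s
  define J where "J s = integral {0..s} Z" for s
  have tI: "s \<in> ?I" if "0 \<le> s" "s \<le> t" for s
    using that t by (auto simp: time_interval_def intro: le_less_trans[of "ereal s" "ereal t"])
  have t0: "0 \<le> t" using t by (simp add: time_interval_def)
  have a2: "wsum (\<lambda>k. symb k ^ 2) (a s)" and a3: "wsum (\<lambda>k. symb k ^ 3) (a s)" if "s \<in> ?I" for s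
    using C0_sobolev_fourier(2)[OF _ that, of 2 u] C0_sobolev_fourier(2)[OF u3 that] u2
    by (auto simp: a_def C1_sobolev_def)
  have b2: "wsum (\<lambda>k. symb k ^ 2) (fourier_coeff (ut s))" if "s \<in> ?I" for s
    using C0_sobolev_fourier(2)[OF _ that, of 2 ut] u2 by (auto simp: C1_sobolev_def)
  have dw: "wsum (diff_weight h) x" "wnorm2 (diff_weight h) x \<le> 4 / h\<^sup>2 * wnorm2 (\<lambda>k. symb k ^ 2) x"
    if "wsum (\<lambda>k. symb k ^ 2) x" for x
    using wsum_mono[OF that diff_weight_nonneg diff_weight_le(2)[OF h]] by auto
  \<comment> \<open>Differentiability in time is known in H^2. For fixed h the comparison with
    constant \<open>4 / h\<^sup>2\<close> transfers it to the difference weight.\<close>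
  have dE: "(E has_real_derivative 2 * winner (diff_weight h) (fourier_coeff (ut s)) (a s)) (at s within ?I)"
    if s: "s \<in> ?I" for s
    unfolding E_def
  proof (rule wnorm2_has_derivative[OF diff_weight_nonneg dw(1)[OF a2] dw(1)[OF b2[OF s]] s])
    let ?y = "\<lambda>r k. (a r k - a s k) / of_real (r - s) - fourier_coeff (ut s) k"
    have "((\<lambda>r. wnorm2 (\<lambda>k. symb k ^ 2) (?y r)) \<longlongrightarrow> 0) (at s within ?I)"
      using C1_sobolev_fourier[OF u2 s] by (simp add: a_def)
    then have l: "((\<lambda>r. 4 / h\<^sup>2 * wnorm2 (\<lambda>k. symb k ^ 2) (?y r)) \<longlongrightarrow> 0) (at s within ?I)"
      by (rule tendsto_mult_right_zero)
    have "wsum (\<lambda>k. symb k ^ 2) (?y r)" if "r \<in> ?I" for r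
    proof -
      have "wsum (\<lambda>k. symb k ^ 2) (\<lambda>k. a r k + (- 1) * a s k)"
        by (rule wnorm2_add(1)[OF _ a2[OF that] wsum_cmult[OF a2[OF s]]]) simp
      from wnorm2_add(1)[OF _ wsum_cmult[OF this, of "1 / of_real (r - s)"] wsum_cmult[OF b2[OF s], of "- 1"]]
      show ?thesis by simp
    qed
    from dw(2)[OF this] have "\<forall>\<^sub>F r in at s within ?I. norm (wnorm2 (diff_weight h) (?y r)) \<le> 4 / h\<^sup>2 * wnorm2 (\<lambda>k. symb k ^ 2) (?y r)"
      by (auto simp: eventually_at_filter wnorm2_nonneg diff_weight_nonneg)
    then show "((\<lambda>r. wnorm2 (diff_weight h) (?y r)) \<longlongrightarrow> 0) (at s within ?I)"
      by (rule Lim_null_comparison[OF _ l])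
  qed
  have rate: "2 * winner (diff_weight h) (fourier_coeff (ut s)) (a s) \<le> 3 * c * M * Z s"
    if s: "s \<in> ?I" "0 < s" for s
  proof -
    obtain utxx ux uxxx where wd: "weak_deriv 2 (ut s) utxx" "weak_deriv 1 (u s) ux" "weak_deriv 3 (u s) uxxx"
      and ae: "AE x in lebesgue. ut s x - utxx x + c * u s x * ux x = c * u s x * uxxx x"
      using eq[OF s] by blast
    have "u s \<in> sobolev 3" using u3 s by (simp add: C0_sobolev_def)
    from equation_fourier[OF this wd ae] obtain C where C:
      "\<And>k. ((\<lambda>j. a s (k - j) * (2 * pi * \<i> * of_int j * (symb j * a s j))) has_sum C k) UNIV"
      "\<And>k. symb k * fourier_coeff (ut s) k = - of_real c * C k"
      unfolding a_def by blast
    \<comment> \<open>The bounded derivative \<open>g\<close> and the derivative \<open>ux\<close>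
      in the equation are obtained separately. Both have their coefficients determined by those of
      u, so the bound on \<open>g\<close> applies to the convolution found with
      \<open>ux\<close>.\<close>
    obtain g where g: "weak_deriv 1 (u s) g" "AE x in circle. \<bar>g x\<bar> \<le> M" using M[OF s(1)] by blast
    show ?thesis unfolding Z a_def[symmetric]
    proof (rule energy_rate_bound[OF a3[OF s(1)] _ g(2) M0 _ _ C h c])
      show "integrable circle g" using g(1) by (simp add: weak_deriv_def)
      show "fourier_coeff g k = 2 * pi * \<i> * of_int k * a s k" for k
        using fourier_coeff_weak_deriv[OF g(1)] by (simp add: a_def)
      show "a s (- k) = cnj (a s k)" for k by (simp add: a_def fourier_coeff_cnj)
    qed
  qed
  have dJ: "(J has_real_derivative Z s) (at s within {0..t})" if "s \<in> {0..t}" for s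
    unfolding J_def by (rule integral_has_real_derivative[OF cZ that])
  \<comment> \<open>The claim is that \<open>Y\<close> does not increase. The equation is available
    at positive times, so the derivative is estimated in the open interval and continuity covers the
    end points.\<close>
  define Y where "Y s = E s - 3 * c * M * J s" for s
  have sub: "{0..t} \<subseteq> ?I" using tI by auto
  have "Y t \<le> Y 0"
  proof (rule DERIV_nonpos_imp_decreasing_open[where f = Y and a = 0 and b = t])
    show "0 \<le> t" by (rule t0)
    have "(E has_real_derivative 2 * winner (diff_weight h) (fourier_coeff (ut s)) (a s)) (at s within {0..t})"
      if "s \<in> {0..t}" for s
      using dE[of s] that sub by (intro DERIV_subset[OF dE sub]) auto
    then have "continuous_on {0..t} E" by (rule DERIV_continuous_on)
    moreover have "continuous_on {0..t} J" using dJ by (rule DERIV_continuous_on)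
    ultimately show "continuous_on {0..t} Y" unfolding Y_def by (intro continuous_intros)
    fix s :: real assume s: "0 < s" "s < t"
    then have at: "at s within {0..t} = at s" by (intro at_within_interior) auto
    have sI: "s \<in> ?I" and s0: "s \<in> {0..t}" using s tI by auto
    have "(E has_real_derivative 2 * winner (diff_weight h) (fourier_coeff (ut s)) (a s)) (at s)"
      using DERIV_subset[OF dE[OF sI] sub] at by simp
    moreover have "(J has_real_derivative Z s) (at s)" using dJ[OF s0] at by simp
    ultimately have "(Y has_real_derivative 2 * winner (diff_weight h) (fourier_coeff (ut s)) (a s) - 3 * c * M * Z s) (at s)"
      unfolding Y_def by (auto intro!: derivative_eq_intros)
    then show "\<exists>y. (Y has_real_derivative y) (at s) \<and> y \<le> 0" using rate[OF sI s(1)] by fastforce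
  qed
  \<comment> \<open>Here the comparison uniform in h enters: the initial energy is bounded
    independently of the step.\<close>
  moreover have "E 0 \<le> Z 0"
    using wsum_mono(2)[where W = "diff_weight h" and K = 1, OF a3[OF tI[of 0]] diff_weight_nonneg] diff_weight_le(1)[OF h] t0
    by (simp add: E_def Z a_def)
  ultimately show ?thesis by (simp add: Y_def J_def E_def a_def)
qed

theorem theorem2p2:
  fixes c :: real and u0 :: "real \<Rightarrow> real" and T :: ereal and u :: "real \<Rightarrow> real \<Rightarrow> real"
  assumes "c > 0"
    and "u0 \<in> sobolev 3"
    and "0 < T"
    and "cauchy_solution c u0 T u"
    and "\<exists>M>0. \<forall>t \<in> time_interval T.
           \<exists>ux. weak_deriv 1 (u t) ux \<and> Linf_norm (u t) + Linf_norm ux < ereal M"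
  shows "T < \<infinity> \<longrightarrow> (SUP t \<in> time_interval T. ereal (sobolev_norm 3 (u t))) < \<infinity>"
proof
  assume "T < \<infinity>"
  then obtain \<tau> where \<tau>: "T = ereal \<tau>" using \<open>0 < T\<close> by (cases T) auto
  let ?I = "time_interval T"
  obtain M where "M > 0" and M: "\<And>t. t \<in> ?I \<Longrightarrow> \<exists>ux. weak_deriv 1 (u t) ux \<and> Linf_norm (u t) + Linf_norm ux < ereal M"
    using assms(5) by blast
  obtain ut where u3: "C0_sobolev T 3 u" and u2: "C1_sobolev T 2 u ut"
    and eq: "\<And>t. t \<in> ?I \<Longrightarrow> t > 0 \<Longrightarrow>
         (\<exists>utxx ux uxxx.
            weak_deriv 2 (ut t) utxx \<and> weak_deriv 1 (u t) ux \<and> weak_deriv 3 (u t) uxxx \<and>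
            (AE x in lebesgue. ut t x - utxx x + c * u t x * ux x = c * u t x * uxxx x))"
    using assms(4) unfolding cauchy_solution_def by blast
  have bounds: "(AE x in circle. \<bar>u t x\<bar> \<le> M) \<and> (\<exists>ux. weak_deriv 1 (u t) ux \<and> (AE x in circle. \<bar>ux x\<bar> \<le> M))"
    if t: "t \<in> ?I" for t
  proof -
    obtain ux where ux: "weak_deriv 1 (u t) ux" "Linf_norm (u t) + Linf_norm ux < ereal M" using M[OF t] by blast
    \<comment> \<open>Both norms are nonnegative, so the bound on their sum bounds each of
      them.\<close>
    have "Linf_norm (u t) \<le> Linf_norm (u t) + Linf_norm ux" "Linf_norm ux \<le> Linf_norm (u t) + Linf_norm ux"
      using Linf_norm_nonneg[of "u t"] Linf_norm_nonneg[of ux] by (simp_all add: ereal_le_add_self ereal_le_add_self2)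
    then have "Linf_norm (u t) \<le> ereal M" "Linf_norm ux \<le> ereal M" using ux(2) by auto
    then show ?thesis using ux(1) AE_le_Linf_norm by blast
  qed
  define Z where "Z s = wnorm2 (\<lambda>k. symb k ^ 3) (fourier_coeff (u s))" for s
  have a3: "wsum (\<lambda>k. symb k ^ 3) (fourier_coeff (u t))" if "t \<in> ?I" for t
    using C0_sobolev_fourier(2)[OF u3 that] by simp
  have cZ: "continuous_on ?I Z"
    unfolding continuous_on_def Z_def
  proof
    fix t assume t: "t \<in> ?I"
    show "((\<lambda>s. wnorm2 (\<lambda>k. symb k ^ 3) (fourier_coeff (u s))) \<longlongrightarrow> wnorm2 (\<lambda>k. symb k ^ 3) (fourier_coeff (u t))) (at t within ?I)"
      by (rule wnorm2_tendsto[OF _ a3 t]) (use C0_sobolev_fourier(3)[OF u3 t] in auto)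
  qed
  \<comment> \<open>As \<open>wnorm2_symb_le\<close> prescribes, the bound of
    \<open>energy_integral_bound\<close> is doubled, and \<open>M\<^sup>2\<close> is added for
    frequency zero.\<close>
  define A where "A = M\<^sup>2 + 2 * Z 0"
  define K where "K = 6 * c * M"
  have K: "0 \<le> K" using \<open>c > 0\<close> \<open>M > 0\<close> by (simp add: K_def)
  have A: "0 \<le> A" by (simp add: A_def Z_def wnorm2_nonneg)
  have main: "Z t \<le> A + K * integral {0..t} Z" if t: "t \<in> ?I" for t
  proof -
    have "{0..t} \<subseteq> ?I"
      using t by (auto simp: time_interval_def intro: le_less_trans[of _ "ereal t"])
    then have "wnorm2 (diff_weight h) (fourier_coeff (u t)) \<le> Z 0 + 3 * c * M * integral {0..t} Z" if "h > 0" for h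
      using \<open>M > 0\<close> bounds
      by (intro energy_integral_bound[OF \<open>c > 0\<close> that u3 u2 eq _ _ t _ continuous_on_subset[OF cZ]])
        (auto simp: Z_def)
    from wnorm2_symb_le[OF a3[OF t] this]
    have "Z t \<le> (norm (fourier_coeff (u t) 0))\<^sup>2 + 2 * (Z 0 + 3 * c * M * integral {0..t} Z)"
      by (simp add: Z_def)
    moreover have "(norm (fourier_coeff (u t) 0))\<^sup>2 \<le> M\<^sup>2"
      using norm_fourier_coeff_le[OF C0_sobolev_fourier(1)[OF u3 t]] bounds[OF t] by (intro power_mono) auto
    ultimately show ?thesis by (simp add: A_def K_def algebra_simps)
  qed
  have "sobolev_norm 3 (u t) \<le> sqrt (A * exp (K * \<tau>))" if t: "t \<in> ?I" for t
  proof -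
    have t0: "0 \<le> t" and t\<tau>: "t \<le> \<tau>" using t by (auto simp: time_interval_def \<tau>)
    have sub: "{0..t} \<subseteq> ?I"
      using t by (auto simp: time_interval_def intro: le_less_trans[of _ "ereal t"])
    have "Z t \<le> A * exp (K * t)"
      by (rule gronwall[OF continuous_on_subset[OF cZ sub] t0 K]) (use main sub in blast)
    \<comment> \<open>Finiteness of T enters here, making the exponential bound uniform in
      t.\<close>
    also have "\<dots> \<le> A * exp (K * \<tau>)"
      using A K t\<tau> by (intro mult_left_mono) (auto intro: mult_left_mono)
    finally show ?thesis by (simp add: sobolev_norm_wnorm2 Z_def)
  qed
  then have "(SUP t \<in> ?I. ereal (sobolev_norm 3 (u t))) \<le> ereal (sqrt (A * exp (K * \<tau>)))"
    by (intro SUP_least) auto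
  then show "(SUP t \<in> ?I. ereal (sobolev_norm 3 (u t))) < \<infinity>"
    by (rule le_less_trans) simp
qed

end
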